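(* Let $G$ be any $2$-connected outerplane near-triangulation with $V(G)=\{x,y,v_1,\dots,v_n\}$ (where $x,y,v_1,\dots,v_n$ are pairwise distinct). Let $C:V(G)\to\{1,2,3\}$ be any proper $3$-colouring of $G$. Then in the graph polynomial $P(G)$: (1) there is no non-vanishing monomial of the form $\eta\, x^0y^0\prod_{i=1}^n v_i^{\alpha_i}$ with all $\alpha_i\le 2$; (2) there is a non-vanishing monomial of the form $\eta\, x^1y^0\prod_{i=1}^n v_i^{\alpha_i}$ with all $\alpha_i\le 2$ if and only if $C(x)\neq C(y)$; (3) there is a non-vanishing monomial of the form $\eta\, x^{\beta}y^{\gamma}\prod_{i=1}^n v_i^{\alpha_i}$ with all $\alpha_i\le 2$ and $\beta,\gamma\le 1$.
   Context: All graphs are simple, undirected and finite. An outerplane graph is a graph embedded in the plane with all vertices on the outer face. A near-triangulation is a plane graph in which every face except the outer one is a triangle. A $2$-connected outerplane near-triangulation has a unique proper $3$-colouring up to permutation of the colours. The graph polynomial of $G$ is $P(G)=\prod_{uv\in E(G),\,u<v}(u-v)$, with the vertices as variables, where $<$ fixes an arbitrary orientation of the edges (changing the orientation only changes the sign of $P(G)$). A monomial is non-vanishing in $P(G)$ if its coefficient $\eta$ in the expanded polynomial is non-zero. *)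

theory Defs
  imports
    "HOL-Analysis.Analysis"
    "HOL-Library.Poly_Mapping"
    "Graph_Theory.Digraph_Component"
    "Graph_Theory.Pair_Digraph"
begin

section \<open>Graphs\<close>

text \<open>
  A finite simple undirected graph is a \<open>pair_graph\<close>: an edge \<open>uv\<close> is represented by the two
  opposite arcs \<open>(u, v)\<close> and \<open>(v, u)\<close>.  The name \<open>connected\<close> has to be qualified below, since
  it also denotes the topological notion.
\<close>

definition k_connected :: "nat \<Rightarrow> 'a pair_pre_digraph \<Rightarrow> bool" where
  "k_connected k G \<longleftrightarrow>
     k < card (pverts G) \<and>
     (\<forall>X \<subseteq> pverts G. card X < k \<longrightarrow>
        Digraph_Component.connected (with_proj G \<restriction> (pverts G - X)))"

definition proper_colouring :: "'a pair_pre_digraph \<Rightarrow> 'c set \<Rightarrow> ('a \<Rightarrow> 'c) \<Rightarrow> bool" where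
  "proper_colouring G K C \<longleftrightarrow>
     (\<forall>v \<in> pverts G. C v \<in> K) \<and> (\<forall>(u, v) \<in> parcs G. C u \<noteq> C v)"

section \<open>Plane graphs\<close>

text \<open>
  The plane is the type of complex numbers.  An embedding consists of a point \<open>pos v\<close> for every
  vertex and a simple curve \<open>crv (u, v)\<close> for every arc; the two arcs of an edge have the same
  trace.
\<close>

definition plane_graph ::
  "'a pair_pre_digraph \<Rightarrow> ('a \<Rightarrow> complex) \<Rightarrow> ('a \<times> 'a \<Rightarrow> real \<Rightarrow> complex) \<Rightarrow> bool" where
  "plane_graph G pos crv \<longleftrightarrow>
     pair_graph G \<and>
     inj_on pos (pverts G) \<and>
     (\<forall>(u, v) \<in> parcs G.
        arc (crv (u, v)) \<and>
        pathstart (crv (u, v)) = pos u \<and> pathfinish (crv (u, v)) = pos v \<and>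
        path_image (crv (v, u)) = path_image (crv (u, v)) \<and>
        path_image (crv (u, v)) \<inter> pos ` pverts G = {pos u, pos v}) \<and>
     (\<forall>(u, v) \<in> parcs G. \<forall>(u', v') \<in> parcs G. {u, v} \<noteq> {u', v'} \<longrightarrow>
        path_image (crv (u, v)) \<inter> path_image (crv (u', v')) \<subseteq> pos ` pverts G)"

definition drawing ::
  "'a pair_pre_digraph \<Rightarrow> ('a \<Rightarrow> complex) \<Rightarrow> ('a \<times> 'a \<Rightarrow> real \<Rightarrow> complex) \<Rightarrow> complex set" where
  "drawing G pos crv = pos ` pverts G \<union> (\<Union>e \<in> parcs G. path_image (crv e))"

definition faces ::
  "'a pair_pre_digraph \<Rightarrow> ('a \<Rightarrow> complex) \<Rightarrow> ('a \<times> 'a \<Rightarrow> real \<Rightarrow> complex) \<Rightarrow> complex set set" where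
  "faces G pos crv = components (- drawing G pos crv)"

text \<open>
  \<open>outside S\<close> is the union of the unbounded components of the complement of \<open>S\<close>; as the
  drawing is compact, there is exactly one such component.
\<close>

definition outer_face ::
  "'a pair_pre_digraph \<Rightarrow> ('a \<Rightarrow> complex) \<Rightarrow> ('a \<times> 'a \<Rightarrow> real \<Rightarrow> complex) \<Rightarrow> complex set" where
  "outer_face G pos crv = outside (drawing G pos crv)"

text \<open>A vertex lies on a face if it belongs to the boundary of the face.\<close>

definition outerplane_graph ::
  "'a pair_pre_digraph \<Rightarrow> ('a \<Rightarrow> complex) \<Rightarrow> ('a \<times> 'a \<Rightarrow> real \<Rightarrow> complex) \<Rightarrow> bool" where
  "outerplane_graph G pos crv \<longleftrightarrow>
     plane_graph G pos crv \<and>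
     (\<forall>v \<in> pverts G. pos v \<in> frontier (outer_face G pos crv))"

definition triangular_face ::
  "'a pair_pre_digraph \<Rightarrow> ('a \<times> 'a \<Rightarrow> real \<Rightarrow> complex) \<Rightarrow> complex set \<Rightarrow> bool" where
  "triangular_face G crv F \<longleftrightarrow>
     (\<exists>a b c. (a, b) \<in> parcs G \<and> (b, c) \<in> parcs G \<and> (c, a) \<in> parcs G \<and>
        frontier F = path_image (crv (a, b)) \<union> path_image (crv (b, c)) \<union> path_image (crv (c, a)))"

definition near_triangulation ::
  "'a pair_pre_digraph \<Rightarrow> ('a \<Rightarrow> complex) \<Rightarrow> ('a \<times> 'a \<Rightarrow> real \<Rightarrow> complex) \<Rightarrow> bool" where
  "near_triangulation G pos crv \<longleftrightarrow>
     plane_graph G pos crv \<and>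
     (\<forall>F \<in> faces G pos crv. F \<noteq> outer_face G pos crv \<longrightarrow> triangular_face G crv F)"

section \<open>The graph polynomial\<close>

text \<open>
  A monomial in variables from \<open>'a\<close> is given by its finitely supported exponent function
  \<open>'a \<Rightarrow>\<^sub>0 nat\<close>, and a polynomial over the integers by its finitely supported coefficient
  function on monomials.
\<close>

type_synonym 'a mpoly_int = "('a \<Rightarrow>\<^sub>0 nat) \<Rightarrow>\<^sub>0 int"

definition var :: "'a \<Rightarrow> 'a mpoly_int" where
  "var u = Poly_Mapping.single (Poly_Mapping.single u 1) 1"

text \<open>
  \<open>prec\<close> need not be an order; it only has to choose one of the two arcs of every edge.
\<close>

definition orients :: "('a \<Rightarrow> 'a \<Rightarrow> bool) \<Rightarrow> 'a pair_pre_digraph \<Rightarrow> bool" where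
  "orients prec G \<longleftrightarrow> (\<forall>(u, v) \<in> parcs G. prec u v \<longleftrightarrow> \<not> prec v u)"

definition graph_poly :: "('a \<Rightarrow> 'a \<Rightarrow> bool) \<Rightarrow> 'a pair_pre_digraph \<Rightarrow> 'a mpoly_int" where
  "graph_poly prec G = (\<Prod>(u, v) \<in> {(u, v) \<in> parcs G. prec u v}. var u - var v)"

definition nonvanishing :: "'a mpoly_int \<Rightarrow> ('a \<Rightarrow>\<^sub>0 nat) \<Rightarrow> bool" where
  "nonvanishing P m \<longleftrightarrow> Poly_Mapping.lookup P m \<noteq> 0"

text \<open>The monomial \<open>x ^ \<beta> * y ^ \<gamma> * (\<Prod>i = 1..n. v i ^ \<alpha> i)\<close>.\<close>

definition xyv_monomial ::
  "'a \<Rightarrow> 'a \<Rightarrow> (nat \<Rightarrow> 'a) \<Rightarrow> nat \<Rightarrow> nat \<Rightarrow> nat \<Rightarrow> (nat \<Rightarrow> nat) \<Rightarrow> ('a \<Rightarrow>\<^sub>0 nat)" where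
  "xyv_monomial x y v n \<beta> \<gamma> \<alpha> =
     Poly_Mapping.single x \<beta> + Poly_Mapping.single y \<gamma> +
     (\<Sum>i = 1..n. Poly_Mapping.single (v i) (\<alpha> i))"

end

theory Submission
  imports Defs
begin

text \<open>
  For a monomial with all exponents at most 2 call \<open>2\<close> minus the exponent of a vertex its
  deficit, and let \<open>C\<close> be a proper colouring by 1, 2, 3.  The theorem is a consequence of a
  formula for coefficients: for some constant \<open>s \<noteq> 0\<close>, the coefficient in \<open>P(G)\<close> of every such
  monomial with total deficit 3 is \<open>s\<close> times \<open>chi\<close> of the sum of the deficits weighted by the
  colours, where \<open>chi\<close> is the quadratic character modulo 3 (\<open>coefficient_two_tree\<close>).  As \<open>P(G)\<close>
  is homogeneous of degree \<open>2 |V| - 3\<close>, monomials with another total deficit do not occur.  In (1)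
  the total deficit is at least 4.  In (2) the deficits must be 1 at \<open>x\<close>, 2 at \<open>y\<close> and 0
  elsewhere, and \<open>C x + 2 C y\<close> is divisible by 3 exactly if \<open>C x = C y\<close>.  For (3), if the colours
  of \<open>x\<close> and \<open>y\<close> agree, deficits 1 at \<open>x\<close>, at \<open>y\<close> and at some vertex of another colour give a
  nonzero coefficient.

  The formula is proved along the construction of \<open>G\<close> as a 2-tree, that is, from an edge by adding
  one vertex \<open>z\<close> at a time, joined to the two ends of an edge \<open>ab\<close> (\<open>chi_law_ear\<close>).  Up to
  sign this multiplies the polynomial by \<open>(z - a) (z - b)\<close>, and the formula survives because the three colours on the
  triangle add up to a multiple of 3 and \<open>chi t + chi (t + 1) + chi (t + 2) = 0\<close>.

  That \<open>G\<close> is a 2-tree follows from 2-connectedness, chordality and the absence of \<open>K\<^sub>4\<close>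
  (\<open>chordal_two_tree\<close>), and topology is only needed for the last two.  All vertices lie on the outer
  face, so the inside of an induced cycle contains no vertex and hence no edge; it is therefore a
  face, and the cycle is a triangle (\<open>induced_cycle_triangle\<close>).  In a \<open>K\<^sub>4\<close> all four triangles would
  bound faces in this way, and Janiszewski's theorem would connect one of these faces to the outer
  face without crossing the \<open>K\<^sub>4\<close> (\<open>K4_free\<close>).
\<close>

section \<open>Chordal graphs without \<open>K\<^sub>4\<close> and 2-trees\<close>

definition induced_path :: "('a \<times> 'a) set \<Rightarrow> 'a list \<Rightarrow> bool" where
  "induced_path E xs \<longleftrightarrow> xs \<noteq> [] \<and> distinct xs \<and>
     (\<forall>i < length xs. \<forall>j < length xs. (xs ! i, xs ! j) \<in> E \<longleftrightarrow> i = Suc j \<or> j = Suc i)"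

text \<open>
  An induced path together with an apex that is adjacent to its two ends only is an induced
  cycle, so this is chordality with one vertex of each induced cycle singled out.
\<close>
definition chordal_on :: "('a \<times> 'a) set \<Rightarrow> 'a set \<Rightarrow> bool" where
  "chordal_on E V \<longleftrightarrow>
     (\<forall>a xs. a \<in> V \<longrightarrow> set xs \<subseteq> V \<longrightarrow> a \<notin> set xs \<longrightarrow> induced_path E xs \<longrightarrow>
        (a, hd xs) \<in> E \<longrightarrow> (a, last xs) \<in> E \<longrightarrow>
        (\<forall>i. 0 < i \<longrightarrow> Suc i < length xs \<longrightarrow> (a, xs ! i) \<notin> E) \<longrightarrow> length xs \<le> 2)"

definition K4_free_on :: "('a \<times> 'a) set \<Rightarrow> 'a set \<Rightarrow> bool" where
  "K4_free_on E V \<longleftrightarrow>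
     \<not> (\<exists>a \<in> V. \<exists>b \<in> V. \<exists>c \<in> V. \<exists>d \<in> V.
          (a, b) \<in> E \<and> (a, c) \<in> E \<and> (a, d) \<in> E \<and> (b, c) \<in> E \<and> (b, d) \<in> E \<and> (c, d) \<in> E)"

definition connected_on :: "('a \<times> 'a) set \<Rightarrow> 'a set \<Rightarrow> bool" where
  "connected_on E V \<longleftrightarrow> (\<forall>u \<in> V. \<forall>w \<in> V. (u, w) \<in> rtrancl_on V E)"

text \<open>
  The 2-trees inside the fixed ambient edge relation, i.e. the induced subgraphs on \<open>V\<close>
  that arise from an edge by repeatedly adding a vertex joined to the two ends of an edge.
\<close>
inductive two_tree :: "('a \<times> 'a) set \<Rightarrow> 'a set \<Rightarrow> bool" for E where
  edge: "(a, b) \<in> E \<Longrightarrow> two_tree E {a, b}"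
| ear: "two_tree E V \<Longrightarrow> a \<in> V \<Longrightarrow> b \<in> V \<Longrightarrow> (a, b) \<in> E \<Longrightarrow> z \<notin> V \<Longrightarrow>
        {w \<in> V. (z, w) \<in> E} = {a, b} \<Longrightarrow> two_tree E (insert z V)"

lemma induced_path_take:
  "induced_path E xs \<Longrightarrow> 0 < n \<Longrightarrow> induced_path E (take n xs)"
  by (auto simp: induced_path_def)

lemma last_take_nth: "i < length xs \<Longrightarrow> last (take (Suc i) xs) = xs ! i"
  by (simp add: take_Suc_conv_app_nth)

lemma induced_path_drop:
  "induced_path E xs \<Longrightarrow> n < length xs \<Longrightarrow> induced_path E (drop n xs)"
  by (auto simp: induced_path_def)

text \<open>
  The form in which connectedness is used below: a cut without edges is trivial.
\<close>
lemma cut_without_edges_trivial: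
  assumes "connected_on E V" "M \<subseteq> V" "M \<noteq> {}"
    and "\<And>u w. u \<in> M \<Longrightarrow> w \<in> V \<Longrightarrow> (u, w) \<in> E \<Longrightarrow> w \<in> M"
  shows "M = V"
proof -
  obtain u where u: "u \<in> M" using assms(3) by blast
  have "w \<in> M" if "w \<in> V" for w
  proof -
    have "(u, w) \<in> rtrancl_on V E"
      using assms(1,2) u that by (auto simp: connected_on_def)
    then show ?thesis
      by (induction rule: rtrancl_on_induct) (use u assms(4) in auto)
  qed
  with assms(2) show ?thesis by blast
qed

locale adjacency =
  fixes E :: "('a \<times> 'a) set"
  assumes sym_E: "(u, w) \<in> E \<Longrightarrow> (w, u) \<in> E"
    and irrefl_E: "(u, u) \<notin> E"
begin

text \<open>
  Extend an induced path \<open>x, \<dots>, y\<close> by a neighbour \<open>z\<close> of \<open>y\<close>: jumping to \<open>z\<close> from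
  the first vertex adjacent to \<open>z\<close> leaves no chord.
\<close>
lemma connected_induced_path:
  assumes "(x, y) \<in> rtrancl_on K E"
  obtains xs where "induced_path E xs" "set xs \<subseteq> K" "hd xs = x" "last xs = y"
proof -
  from assms have "\<exists>xs. induced_path E xs \<and> set xs \<subseteq> K \<and> hd xs = x \<and> last xs = y"
  proof (induction rule: rtrancl_on_induct)
    case base
    then show ?case
      by (intro exI[of _ "[x]"]) (auto simp: induced_path_def irrefl_E)
  next
    case (step y z)
    then obtain xs where xs: "induced_path E xs" "set xs \<subseteq> K" "hd xs = x" "last xs = y" by blast
    have ne: "xs \<noteq> []" using xs(1) by (simp add: induced_path_def)
    show ?case
    proof (cases "z \<in> set xs")
      case True
      then obtain i where i: "i < length xs" "xs ! i = z" by (auto simp: in_set_conv_nth)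
      show ?thesis
        using xs i induced_path_take[OF xs(1), of "Suc i"]
        by (intro exI[of _ "take (Suc i) xs"]) (auto simp: last_take_nth dest: in_set_takeD)
    next
      case False
      define P where "P i \<longleftrightarrow> i < length xs \<and> (xs ! i, z) \<in> E" for i
      define i where "i = (LEAST i. P i)"
      have "P (length xs - 1)"
        using ne xs(4) step.hyps by (auto simp: P_def last_conv_nth)
      then have Pi: "P i" unfolding i_def by (rule LeastI)
      have least: "\<not> P j" if "j < i" for j using that unfolding i_def by (rule not_less_Least)
      let ?ys = "take (Suc i) xs @ [z]"
      have len: "i < length xs" using Pi by (simp add: P_def)
      have nth: "?ys ! j = (if j \<le> i then xs ! j else z)" if "j < length ?ys" for j
        using that len by (auto simp: nth_append)
      have adj: "(xs ! j, z) \<in> E \<longleftrightarrow> j = i" if "j \<le> i" for j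
        using least[of j] that Pi len by (cases "j = i") (auto simp: P_def)
      have adj': "(z, xs ! j) \<in> E \<longleftrightarrow> j = i" if "j \<le> i" for j
        using adj[OF that] sym_E by blast
      have "induced_path E ?ys"
        unfolding induced_path_def
      proof (intro conjI allI impI)
        show "?ys \<noteq> []" by simp
        show "distinct ?ys"
          using xs(1) False by (auto simp: induced_path_def dest: in_set_takeD)
        fix j k assume j: "j < length ?ys" and k: "k < length ?ys"
        have j': "j \<le> i \<or> j = Suc i" and k': "k \<le> i \<or> k = Suc i" using j k len by auto
        show "(?ys ! j, ?ys ! k) \<in> E \<longleftrightarrow> j = Suc k \<or> k = Suc j"
          unfolding nth[OF j] nth[OF k]
          using j' k' len xs(1) by (auto simp: adj adj' irrefl_E induced_path_def)
      qed
      then show ?thesis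
        using xs ne step.hyps len
        by (intro exI[of _ ?ys]) (auto dest: in_set_takeD)
    qed
  qed
  with that show ?thesis by blast
qed

text \<open>
  Chordality forces an interior neighbour of \<open>a\<close> on the path; the path then splits there into
  two shorter paths of the same kind.
\<close>
lemma apex_adjacent_to_path:
  assumes ch: "chordal_on E V" and "a \<in> V" "a \<notin> set xs" "set xs \<subseteq> V" "induced_path E xs"
    and "(a, hd xs) \<in> E" "(a, last xs) \<in> E" "w \<in> set xs"
  shows "(a, w) \<in> E"
  using assms(3-8)
proof (induction "length xs" arbitrary: xs rule: less_induct)
  case less
  have ne: "xs \<noteq> []" using less.prems(3) by (simp add: induced_path_def)
  show ?case
  proof (cases "length xs \<le> 2")
    case True
    with ne obtain p q where "xs = [p] \<or> xs = [p, q]"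
      by (cases xs; cases "tl xs"; cases "tl (tl xs)") auto
    with less.prems show ?thesis by auto
  next
    case False
    then obtain i where i: "0 < i" "Suc i < length xs" "(a, xs ! i) \<in> E"
      using ch[unfolded chordal_on_def, rule_format, OF \<open>a \<in> V\<close> less.prems(2,1,3,4,5)] by blast
    have "w \<in> set (take (Suc i) xs) \<or> w \<in> set (drop i xs)"
    proof -
      have "w \<in> set (take i xs) \<or> w \<in> set (drop i xs)"
        using less.prems(6) by (metis UnE append_take_drop_id set_append)
      then show ?thesis using set_take_subset_set_take[of i "Suc i" xs] by auto
    qed
    then show ?thesis
    proof
      assume "w \<in> set (take (Suc i) xs)"
      then show ?thesis
        using less.prems i ne induced_path_take[OF less.prems(3), of "Suc i"]
        by (intro less.hyps[of "take (Suc i) xs"])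
          (auto simp: last_take_nth dest: in_set_takeD)
    next
      assume "w \<in> set (drop i xs)"
      then show ?thesis
        using less.prems i ne induced_path_drop[OF less.prems(3), of i]
        by (intro less.hyps[of "drop i xs"])
          (auto simp: hd_drop_conv_nth dest: in_set_dropD)
    qed
  qed
qed

text \<open>
  An induced path through \<open>M\<close> from a neighbour of \<open>a\<close> to \<open>b\<close> has both ends adjacent to
  \<open>a\<close>, so \<open>a\<close> is adjacent to all of it, in particular to the vertex just before \<open>b\<close>.
\<close>
lemma common_neighbour:
  assumes ch: "chordal_on E V" and ab: "(a, b) \<in> E" "a \<in> V" "b \<in> V"
    and M: "connected_on E M" "M \<subseteq> V" "a \<notin> M" "b \<notin> M"
    and p: "p \<in> M" "(a, p) \<in> E" and q: "q \<in> M" "(q, b) \<in> E"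
  obtains c where "c \<in> M" "(a, c) \<in> E" "(b, c) \<in> E"
proof -
  have "(p, q) \<in> rtrancl_on M E" using M(1) p q by (auto simp: connected_on_def)
  then have "(p, q) \<in> rtrancl_on (insert b M) E"
    by (rule rtrancl_on_mono[rotated 2]) auto
  then have "(p, b) \<in> rtrancl_on (insert b M) E"
    using q by (auto intro: rtrancl_on_into_rtrancl_on)
  then obtain xs where xs: "induced_path E xs" "set xs \<subseteq> insert b M" "hd xs = p" "last xs = b"
    by (rule connected_induced_path)
  define n where "n = length xs"
  have ne: "xs \<noteq> []" using xs(1) by (simp add: induced_path_def)
  have n: "n \<ge> 2"
  proof (rule ccontr)
    assume "\<not> n \<ge> 2"
    then have "xs = [hd xs]" using ne by (cases xs; cases "tl xs") (auto simp: n_def)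
    then have "hd xs = last xs" by (metis last.simps)
    with xs p M show False by auto
  qed
  let ?c = "xs ! (n - 2)"
  have l: "xs ! (n - 1) = b" using xs(4) ne by (simp add: n_def last_conv_nth)
  have cxs: "?c \<in> set xs" using n by (simp add: n_def)
  have "a \<notin> set xs" using xs(2) M ab irrefl_E by blast
  then have "(a, ?c) \<in> E"
    using apex_adjacent_to_path[OF ch ab(2) _ _ xs(1) _ _ cxs] xs p ab M by auto
  moreover have "(?c, xs ! (n - 1)) \<in> E"
    using xs(1) n by (auto simp: induced_path_def n_def)
  ultimately show ?thesis
    using that[of ?c] l cxs xs(2) irrefl_E sym_E by auto
qed

text \<open>
  \<open>K\<close> is a nonempty union of components of the graph on \<open>V\<close> after removal of the ends of an
  edge.
\<close>
definition closed_off :: "'a set \<Rightarrow> 'a \<Rightarrow> 'a \<Rightarrow> 'a set \<Rightarrow> bool" where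
  "closed_off V a b K \<longleftrightarrow> a \<in> V \<and> b \<in> V \<and> (a, b) \<in> E \<and> K \<subseteq> V - {a, b} \<and> K \<noteq> {} \<and>
     (\<forall>u \<in> K. \<forall>w \<in> V - {a, b}. (u, w) \<in> E \<longrightarrow> w \<in> K)"

lemma component_connected:
  assumes "w \<in> S"
  defines "M \<equiv> {m. (w, m) \<in> rtrancl_on S E}"
  shows "w \<in> M" "M \<subseteq> S" "connected_on E M"
    "\<And>u v. u \<in> M \<Longrightarrow> v \<in> S \<Longrightarrow> (u, v) \<in> E \<Longrightarrow> v \<in> M"
proof -
  show "w \<in> M" using assms by auto
  show "M \<subseteq> S" using assms by (auto dest: in_rtrancl_on_in_F)
  show cl: "\<And>u v. u \<in> M \<Longrightarrow> v \<in> S \<Longrightarrow> (u, v) \<in> E \<Longrightarrow> v \<in> M"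
    by (auto simp: M_def intro: rtrancl_on_into_rtrancl_on)
  have *: "(w, m) \<in> rtrancl_on M E" if "m \<in> M" for m
  proof -
    from that have "(w, m) \<in> rtrancl_on S E" by (simp add: M_def)
    then show ?thesis
    proof (induction rule: rtrancl_on_induct)
      case base show ?case using \<open>w \<in> M\<close> by simp
    next
      case (step y z)
      then have "z \<in> M" by (auto simp: M_def intro: rtrancl_on_into_rtrancl_on)
      with step show ?case by (auto intro: rtrancl_on_into_rtrancl_on)
    qed
  qed
  have "sym E" using sym_E by (auto intro: symI)
  then have "sym (rtrancl_on M E)" by (rule rtrancl_on_sym)
  then show "connected_on E M"
    unfolding connected_on_def by (meson * rtrancl_on_trans symE)
qed

text \<open>
  Otherwise \<open>b\<close> alone would separate \<open>K\<close> from \<open>a\<close>.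
\<close>
lemma closed_off_neighbour:
  assumes conn: "\<And>x. x \<in> V \<Longrightarrow> connected_on E (V - {x})"
    and K: "closed_off V a b K"
  obtains p where "p \<in> K" "(a, p) \<in> E"
proof (rule ccontr)
  assume "\<not> thesis"
  with that have no: "\<And>p. p \<in> K \<Longrightarrow> (p, a) \<notin> E" using sym_E by blast
  have "K = V - {b}"
    using K no by (intro cut_without_edges_trivial[of E]) (auto simp: closed_off_def conn)
  with K show False using irrefl_E by (auto simp: closed_off_def)
qed

lemma closed_off_commute: "closed_off V a b K \<longleftrightarrow> closed_off V b a K"
  using sym_E by (auto simp: closed_off_def insert_commute)

text \<open>
  Among all edges \<open>ab\<close> and all sets closed off by their ends take a smallest such set \<open>K\<close>.
  It is connected, so it contains a common neighbour \<open>c\<close> of \<open>a\<close> and \<open>b\<close>.  If \<open>K\<close> were larger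
  than \<open>{c}\<close>, a component \<open>M\<close> of \<open>K - {c}\<close> would have neighbours at both \<open>a\<close> and \<open>b\<close>: else
  it would be closed off by \<open>a\<close>, \<open>c\<close> or by \<open>b\<close>, \<open>c\<close>, against minimality.  Hence \<open>M\<close> contains
  a second common neighbour \<open>d\<close>.  Both \<open>a\<close> and \<open>b\<close> are then adjacent to every vertex of an
  induced path in \<open>K\<close> from \<open>c\<close> to \<open>d\<close>, and its first edge completes a \<open>K\<^sub>4\<close>.  So \<open>c\<close> is
  the ear.
\<close>
lemma obtain_ear:
  assumes fin: "finite V" and card: "card V \<ge> 3"
    and conn: "\<And>x. x \<in> V \<Longrightarrow> connected_on E (V - {x})"
    and ch: "chordal_on E V" and K4: "K4_free_on E V"
  obtains a b z where "a \<in> V" "b \<in> V" "z \<in> V" "a \<noteq> z" "b \<noteq> z" "(a, b) \<in> E"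
    "{w \<in> V. (z, w) \<in> E} = {a, b}"
proof -
  have "\<exists>T. T \<subseteq> V \<and> card T = 3" using card by (meson obtain_subset_with_card_n)
  then obtain x y t where xyt: "x \<in> V" "y \<in> V" "t \<in> V" "x \<noteq> y" "x \<noteq> t" "y \<noteq> t"
    by (auto simp: card_3_iff)
  have "\<exists>u. (x, u) \<in> E \<and> u \<in> V"
  proof (rule ccontr)
    assume no: "\<not> ?thesis"
    have eq: "{x} = V - {t}"
    proof (rule cut_without_edges_trivial[OF conn[OF xyt(3)]])
      show "{x} \<subseteq> V - {t}" using xyt by simp
      show "w \<in> {x}" if "u \<in> {x}" "w \<in> V - {t}" "(u, w) \<in> E" for u w
        using no that by simp
    qed simp
    have "y \<in> V - {t}" using xyt by simp
    then have "y \<in> {x}" unfolding eq .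
    with xyt show False by simp
  qed
  then obtain u where u: "(x, u) \<in> E" "u \<in> V" by blast
  have "\<exists>s \<in> V. s \<notin> {x, u}" using xyt by (cases "u = y") auto
  then have "closed_off V x u (V - {x, u})"
    using xyt u by (auto simp: closed_off_def)
  then have ex: "\<exists>n a b K. closed_off V a b K \<and> card K = n" by blast
  define n where "n = (LEAST n. \<exists>a b K. closed_off V a b K \<and> card K = n)"
  have least: "n \<le> card K" if "closed_off V a b K" for a b K
    unfolding n_def using that by (intro Least_le) blast
  have "\<exists>a b K. closed_off V a b K \<and> card K = n"
    unfolding n_def by (rule LeastI_ex[OF ex])
  then obtain a b K where K: "closed_off V a b K" and cK: "card K = n" by blast
  have finK: "finite K" using K fin unfolding closed_off_def by (meson finite_Diff finite_subset)
  have K': "a \<in> V" "b \<in> V" "(a, b) \<in> E" "K \<subseteq> V" "a \<notin> K" "b \<notin> K"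
    "\<And>u w. u \<in> K \<Longrightarrow> w \<in> V \<Longrightarrow> w \<noteq> a \<Longrightarrow> w \<noteq> b \<Longrightarrow> (u, w) \<in> E \<Longrightarrow> w \<in> K"
    using K by (auto simp: closed_off_def)
  have minimal: "K' = K" if "closed_off V a' b' K'" "K' \<subseteq> K" for a' b' K'
    using card_seteq[OF finK that(2)] least[OF that(1)] cK by simp
  have connK: "connected_on E K"
  proof -
    obtain w where w: "w \<in> K" using K by (auto simp: closed_off_def)
    define M where "M = {m. (w, m) \<in> rtrancl_on K E}"
    have M: "w \<in> M" "M \<subseteq> K" "connected_on E M"
        "\<And>u v. u \<in> M \<Longrightarrow> v \<in> K \<Longrightarrow> (u, v) \<in> E \<Longrightarrow> v \<in> M"
      using component_connected[OF w] unfolding M_def by blast+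
    have "closed_off V a b M"
      using M K' unfolding closed_off_def by blast
    then have "M = K" using M(2) by (rule minimal)
    with M(3) show ?thesis by simp
  qed
  obtain p where p: "p \<in> K" "(a, p) \<in> E" using conn K by (rule closed_off_neighbour)
  obtain q where q: "q \<in> K" "(b, q) \<in> E"
    using conn K unfolding closed_off_commute[of V a] by (rule closed_off_neighbour)
  obtain c where c: "c \<in> K" "(a, c) \<in> E" "(b, c) \<in> E"
    using common_neighbour[OF ch K'(3,1,2) connK K'(4-6) p q(1) sym_E[OF q(2)]] .
  have "K = {c}"
  proof (rule ccontr)
    assume "K \<noteq> {c}"
    then obtain w where w: "w \<in> K - {c}" using c by blast
    define M where "M = {m. (w, m) \<in> rtrancl_on (K - {c}) E}"
    have M: "w \<in> M" "M \<subseteq> K - {c}" "connected_on E M"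
        "\<And>u v. u \<in> M \<Longrightarrow> v \<in> K - {c} \<Longrightarrow> (u, v) \<in> E \<Longrightarrow> v \<in> M"
      using component_connected[OF w] unfolding M_def by blast+
    have cV: "c \<in> V" using c K' by blast
    have not_closed: "\<not> closed_off V a' c M" for a'
      using minimal[of a' c M] M(2) c(1) by blast
    obtain p' where p': "p' \<in> M" "(p', b) \<in> E"
      using not_closed[of a] M K' c(2) cV unfolding closed_off_def by blast
    obtain q' where q': "q' \<in> M" "(q', a) \<in> E"
      using not_closed[of b] M K' c(3) cV unfolding closed_off_def by blast
    have MV: "M \<subseteq> V" "a \<notin> M" "b \<notin> M" using M(2) K' by blast+
    obtain d where d: "d \<in> M" "(a, d) \<in> E" "(b, d) \<in> E"
      using common_neighbour[OF ch K'(3,1,2) M(3) MV q'(1) sym_E[OF q'(2)] p'] .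
    have dK: "d \<in> K" "d \<noteq> c" using d M by auto
    have "(c, d) \<in> rtrancl_on K E" using connK c dK by (auto simp: connected_on_def)
    then obtain xs where xs: "induced_path E xs" "set xs \<subseteq> K" "hd xs = c" "last xs = d"
      by (rule connected_induced_path)
    have ne: "xs \<noteq> []" using xs(1) by (simp add: induced_path_def)
    then obtain r rs where rs: "xs = c # r # rs"
      using xs(3,4) dK by (cases xs; cases "tl xs") auto
    have "\<forall>i<length xs. \<forall>j<length xs. (xs ! i, xs ! j) \<in> E \<longleftrightarrow> i = Suc j \<or> j = Suc i"
      using xs(1) by (simp add: induced_path_def)
    from this[rule_format, of 0 1] have "(c, r) \<in> E" by (simp add: rs)
    moreover have "(a, r) \<in> E"
      using apex_adjacent_to_path[OF ch K'(1) _ _ xs(1), of r] xs c d K' by (auto simp: rs)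
    moreover have "(b, r) \<in> E"
      using apex_adjacent_to_path[OF ch K'(2) _ _ xs(1), of r] xs c d K' by (auto simp: rs)
    moreover have "r \<in> V" using xs(2) rs K'(4) by auto
    ultimately show False
      using K4 K' c cV unfolding K4_free_on_def by blast
  qed
  then have "{w \<in> V. (c, w) \<in> E} = {a, b}"
  proof -
    have "w = a \<or> w = b" if "w \<in> V" "(c, w) \<in> E" for w
      using K'(7)[OF c(1) that(1) _ _ that(2)] \<open>K = {c}\<close> irrefl_E that(2) by blast
    then show ?thesis using K'(1,2) c(2,3) sym_E by blast
  qed
  with that[of a b c] K' c show ?thesis by auto
qed

text \<open>
  An induced path through \<open>z\<close> would pass \<open>a\<close>, \<open>z\<close>, \<open>b\<close>, contrary to the chord \<open>ab\<close>.
\<close>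
lemma connected_remove_ear:
  assumes conn: "connected_on E V" and ab: "(a, b) \<in> E" and z: "{w \<in> V. (z, w) \<in> E} \<subseteq> {a, b}"
  shows "connected_on E (V - {z})"
  unfolding connected_on_def
proof (intro ballI)
  fix u w assume uw: "u \<in> V - {z}" "w \<in> V - {z}"
  then have "(u, w) \<in> rtrancl_on V E" using conn by (auto simp: connected_on_def)
  then obtain xs where xs: "induced_path E xs" "set xs \<subseteq> V" "hd xs = u" "last xs = w"
    by (rule connected_induced_path)
  have ne: "xs \<noteq> []" and dist: "distinct xs"
    and adj: "\<And>i j. i < length xs \<Longrightarrow> j < length xs \<Longrightarrow> (xs ! i, xs ! j) \<in> E \<longleftrightarrow> i = Suc j \<or> j = Suc i"
    using xs(1) by (auto simp: induced_path_def)
  have "z \<notin> set xs"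
  proof
    assume "z \<in> set xs"
    then obtain i where i: "i < length xs" "xs ! i = z" by (auto simp: in_set_conv_nth)
    have i0: "i \<noteq> 0" using i xs(3) uw ne by (metis DiffD2 hd_conv_nth singletonI)
    have il: "Suc i < length xs"
      using i xs(4) uw ne by (metis DiffD2 Suc_lessI diff_Suc_1 last_conv_nth singletonI)
    define p q where "p = xs ! (i - 1)" and "q = xs ! Suc i"
    have "p \<in> V" "q \<in> V" using xs(2) i0 il by (auto simp: p_def q_def)
    moreover have "(z, p) \<in> E" "(z, q) \<in> E" "(p, q) \<notin> E"
      using adj[of i "i - 1"] adj[of i "Suc i"] adj[of "i - 1" "Suc i"] i i0 il
      by (auto simp: p_def q_def)
    moreover have "p \<noteq> q" using dist i0 il by (auto simp: p_def q_def nth_eq_iff_index_eq)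
    ultimately show False using z ab sym_E[OF ab] by blast
  qed
  have "(u, xs ! i) \<in> rtrancl_on (V - {z}) E" if "i < length xs" for i
    using that
  proof (induction i)
    case 0
    then show ?case using xs(3) uw ne by (simp add: hd_conv_nth)
  next
    case (Suc i)
    then have "(xs ! i, xs ! Suc i) \<in> E" using adj by auto
    moreover have "xs ! Suc i \<in> V - {z}" using Suc.prems xs(2) \<open>z \<notin> set xs\<close> nth_mem by blast
    ultimately show ?case using Suc by (auto intro: rtrancl_on_into_rtrancl_on)
  qed
  from this[of "length xs - 1"] show "(u, w) \<in> rtrancl_on (V - {z}) E"
    using ne xs(4) by (simp add: last_conv_nth)
qed

theorem chordal_two_tree:
  assumes "finite V" "card V \<ge> 3" "\<And>x. x \<in> V \<Longrightarrow> connected_on E (V - {x})"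
    "chordal_on E V" "K4_free_on E V"
  shows "two_tree E V"
  using assms
proof (induction "card V" arbitrary: V rule: less_induct)
  case less
  obtain a b z where abz: "a \<in> V" "b \<in> V" "z \<in> V" "a \<noteq> z" "b \<noteq> z" "(a, b) \<in> E"
      "{w \<in> V. (z, w) \<in> E} = {a, b}"
    using obtain_ear[OF less.prems(1-5)] by blast
  define W where "W = V - {z}"
  have V: "V = insert z W" "z \<notin> W" using abz(3) by (auto simp: W_def)
  have cW: "card W < card V" using less.prems(1) abz(3) unfolding W_def by (rule card_Diff1_less)
  have nb: "{w \<in> W. (z, w) \<in> E} = {a, b}" using abz by (auto simp: W_def)
  have abW: "a \<in> W" "b \<in> W" using abz by (auto simp: W_def)
  have neq: "a \<noteq> b" using abz(6) irrefl_E by blast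
  have "two_tree E W"
  proof (cases "card V = 3")
    case True
    then have "card W = 2" using less.prems(1) abz(3) by (simp add: W_def)
    moreover have "{a, b} \<subseteq> W" using abW by simp
    ultimately have "{a, b} = W"
      using less.prems(1) neq by (intro card_subset_eq) (auto simp: W_def)
    with two_tree.edge[OF abz(6)] show ?thesis by simp
  next
    case False
    show ?thesis
    proof (rule less.hyps[OF cW])
      show "finite W" using less.prems(1) by (simp add: W_def)
      show "3 \<le> card W" using False less.prems(1,2) abz(3) by (simp add: W_def)
      fix x assume x: "x \<in> W"
      have "W - {x} = V - {x} - {z}" by (auto simp: W_def)
      then show "connected_on E (W - {x})"
        using connected_remove_ear[OF less.prems(3)[of x] abz(6), of z] x abz(7)
        by (auto simp: W_def)
    next
      show "chordal_on E W" using less.prems(4) unfolding chordal_on_def W_def by blast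
      show "K4_free_on E W" using less.prems(5) unfolding K4_free_on_def W_def by blast
    qed
  qed
  then show ?case unfolding V(1) using abW abz(6) V(2) nb by (rule two_tree.ear)
qed

end

lemma two_tree_finite: "two_tree E V \<Longrightarrow> finite V"
  by (induction rule: two_tree.induct) auto

lemma two_tree_contains_edge:
  "two_tree E V \<Longrightarrow> \<exists>a b. a \<in> V \<and> b \<in> V \<and> (a, b) \<in> E"
  by (induction rule: two_tree.induct) blast+

section \<open>Coefficients of the graph polynomial of a 2-tree\<close>

text \<open>
  The graph polynomial of the subgraph induced on \<open>V\<close>, so that the induction over 2-trees can
  vary the vertex set alone.
\<close>
definition orientation_poly :: "('a \<times> 'a) set \<Rightarrow> ('a \<Rightarrow> 'a \<Rightarrow> bool) \<Rightarrow> 'a set \<Rightarrow> 'a mpoly_int" where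
  "orientation_poly E prec V =
     (\<Prod>(u, w) \<in> {(u, w) \<in> E. u \<in> V \<and> w \<in> V \<and> prec u w}. var u - var w)"

text \<open>
  The quadratic character modulo 3.
\<close>
definition chi :: "int \<Rightarrow> int" where
  "chi t = (if t mod 3 = 0 then 0 else if t mod 3 = 1 then 1 else -1)"

text \<open>
  Exponents are measured by how far they fall short of 2, weighted by \<open>f\<close>: weight 1 gives the
  total shortfall, and the colours as weights give the argument of \<open>chi\<close> in the coefficient
  formula.
\<close>
definition deficit :: "'a set \<Rightarrow> ('a \<Rightarrow> int) \<Rightarrow> ('a \<Rightarrow>\<^sub>0 nat) \<Rightarrow> int" where
  "deficit V f m = (\<Sum>v\<in>V. (2 - int (Poly_Mapping.lookup m v)) * f v)"

text \<open>
  Besides the degree this records that no variable outside \<open>V\<close> occurs.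
\<close>
definition homogeneous_on :: "'a set \<Rightarrow> nat \<Rightarrow> 'a mpoly_int \<Rightarrow> bool" where
  "homogeneous_on V k p \<longleftrightarrow>
     (\<forall>m. Poly_Mapping.lookup p m \<noteq> 0 \<longrightarrow>
        Poly_Mapping.keys m \<subseteq> V \<and> (\<Sum>v\<in>V. Poly_Mapping.lookup m v) = k)"

lemma chi_eq_0_iff: "chi t = 0 \<longleftrightarrow> 3 dvd t"
  by (auto simp: chi_def dvd_eq_mod_eq_0)

lemma chi_cong: "t mod 3 = s mod 3 \<Longrightarrow> chi t = chi s"
  by (simp add: chi_def)

text \<open>
  The three arguments run through all residues modulo 3.
\<close>
lemma chi_three:
  assumes "p \<in> {1,2,3}" "q \<in> {1,2,3}" "r \<in> {1,2,3}" "p \<noteq> q" "p \<noteq> r" "q \<noteq> (r::int)"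
  shows "chi (s + p) + chi (s + q) + chi (s + r) = 0"
proof -
  have *: "chi (s + 1) + chi (s + 2) + chi (s + 3) = 0"
  proof -
    have "s mod 3 = 0 \<or> s mod 3 = 1 \<or> s mod 3 = 2" by presburger
    then show ?thesis
    proof (elim disjE)
      assume "s mod 3 = 0"
      then have "(s+1) mod 3 = 1" "(s+2) mod 3 = 2" "(s+3) mod 3 = 0" by presburger+
      then show ?thesis by (simp add: chi_def)
    next
      assume "s mod 3 = 1"
      then have "(s+1) mod 3 = 2" "(s+2) mod 3 = 0" "(s+3) mod 3 = 1" by presburger+
      then show ?thesis by (simp add: chi_def)
    next
      assume "s mod 3 = 2"
      then have "(s+1) mod 3 = 0" "(s+2) mod 3 = 1" "(s+3) mod 3 = 2" by presburger+
      then show ?thesis by (simp add: chi_def)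
    qed
  qed
  from assms show ?thesis using * by (elim insertE emptyE) (auto simp: algebra_simps)
qed

lemma lookup_var_mult:
  "Poly_Mapping.lookup (var u * p) m =
     (if Poly_Mapping.lookup m u = 0 then 0 else Poly_Mapping.lookup p (m - Poly_Mapping.single u 1))"
proof -
  let ?s = "Poly_Mapping.single u (1::nat)"
  have "Poly_Mapping.lookup (var u * p) m =
      (\<Sum>l. (\<Sum>q. Poly_Mapping.lookup p q when m = l + q) when l = ?s)"
    unfolding lookup_mult var_def
    by (intro arg_cong[where f = Sum_any] ext) (simp add: lookup_single when_def)
  also have "\<dots> = (\<Sum>q. Poly_Mapping.lookup p q when m = ?s + q)"
    by (rule Sum_any_when_equal)
  also have "\<dots> = (if Poly_Mapping.lookup m u = 0 then 0 else Poly_Mapping.lookup p (m - ?s))"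
  proof (cases "Poly_Mapping.lookup m u = 0")
    case True
    have "m \<noteq> ?s + q" for q using True by (auto simp: lookup_add)
    then show ?thesis using True by simp
  next
    case False
    have "m = ?s + q \<longleftrightarrow> q = m - ?s" for q
    proof
      assume "q = m - ?s"
      then show "m = ?s + q"
        using False by (intro poly_mapping_eqI) (auto simp: lookup_add lookup_minus lookup_single when_def)
    qed simp
    then show ?thesis using False by simp
  qed
  finally show ?thesis .
qed

lemma homogeneous_on_var_mult:
  assumes p: "homogeneous_on V k p" and u: "u \<in> V" and fin: "finite V"
  shows "homogeneous_on V (Suc k) (var u * p)"
  unfolding homogeneous_on_def
proof (intro allI impI)
  fix m assume "Poly_Mapping.lookup (var u * p) m \<noteq> 0"
  then have m: "Poly_Mapping.lookup m u \<noteq> 0"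
      "Poly_Mapping.lookup p (m - Poly_Mapping.single u 1) \<noteq> 0"
    by (auto simp: lookup_var_mult split: if_splits)
  let ?m = "m - Poly_Mapping.single u 1"
  have keys: "Poly_Mapping.keys ?m \<subseteq> V" and k: "(\<Sum>v\<in>V. Poly_Mapping.lookup ?m v) = k"
    using p m(2) by (auto simp: homogeneous_on_def)
  have eq: "Poly_Mapping.lookup m v = Poly_Mapping.lookup ?m v + (if v = u then 1 else 0)" for v
    using m(1) by (simp add: lookup_minus lookup_single when_def)
  have "(\<Sum>v\<in>V. Poly_Mapping.lookup m v) = k + 1"
    unfolding eq sum.distrib k using u fin by simp
  moreover have "Poly_Mapping.keys m \<subseteq> V"
  proof
    fix x assume x: "x \<in> Poly_Mapping.keys m"
    show "x \<in> V"
    proof (cases "x = u")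
      case False
      then have "x \<in> Poly_Mapping.keys ?m" using x eq[of x] by (simp add: in_keys_iff)
      with keys show ?thesis by blast
    qed (use u in simp)
  qed
  ultimately show "Poly_Mapping.keys m \<subseteq> V \<and> (\<Sum>v\<in>V. Poly_Mapping.lookup m v) = Suc k" by simp
qed

lemma homogeneous_on_minus:
  "homogeneous_on V k p \<Longrightarrow> homogeneous_on V k q \<Longrightarrow> homogeneous_on V k (p - q)"
  unfolding homogeneous_on_def by (metis diff_self lookup_minus)

lemma homogeneous_on_uminus:
  "homogeneous_on V k p \<Longrightarrow> homogeneous_on V k (- p)"
  unfolding homogeneous_on_def by simp

lemma homogeneous_on_insert:
  assumes "homogeneous_on V k p" "finite V" "z \<notin> V"
  shows "homogeneous_on (insert z V) k p"
  unfolding homogeneous_on_def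
proof (intro allI impI)
  fix m assume "Poly_Mapping.lookup p m \<noteq> 0"
  with assms(1) have "Poly_Mapping.keys m \<subseteq> V" "(\<Sum>v\<in>V. Poly_Mapping.lookup m v) = k"
    by (auto simp: homogeneous_on_def)
  moreover from this have "Poly_Mapping.lookup m z = 0" using assms(3) by (auto simp: in_keys_iff)
  ultimately show "Poly_Mapping.keys m \<subseteq> insert z V \<and>
      (\<Sum>v\<in>insert z V. Poly_Mapping.lookup m v) = k"
    using assms by auto
qed

locale oriented_graph = adjacency E for E :: "('a \<times> 'a) set" +
  fixes prec :: "'a \<Rightarrow> 'a \<Rightarrow> bool"
  assumes prec: "(u, w) \<in> E \<Longrightarrow> prec u w \<longleftrightarrow> \<not> prec w u"
begin

abbreviation "P \<equiv> orientation_poly E prec"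

lemma orientation_poly_edge:
  assumes "(a, b) \<in> E"
  shows "P {a, b} = var a - var b \<or> P {a, b} = - (var a - var b)"
proof -
  have "{(u, w) \<in> E. u \<in> {a, b} \<and> w \<in> {a, b} \<and> prec u w} = (if prec a b then {(a, b)} else {(b, a)})"
    using assms sym_E[OF assms] irrefl_E prec[OF assms] by auto
  then show ?thesis by (simp add: orientation_poly_def)
qed

lemma orientation_poly_ear:
  assumes V: "finite V" "z \<notin> V" "a \<noteq> b" "{w \<in> V. (z, w) \<in> E} = {a, b}"
  shows "P (insert z V) = (var z - var a) * ((var z - var b) * P V) \<or>
         P (insert z V) = - ((var z - var a) * ((var z - var b) * P V))"
proof -
  let ?f = "\<lambda>(u, w). var u - var w :: 'a mpoly_int"
  define e where "e c = (if prec z c then (z, c) else (c, z))" for c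
  have zab: "(z, a) \<in> E" "(z, b) \<in> E" "a \<in> V" "b \<in> V" using V by blast+
  have z: "\<And>w. w \<in> V \<Longrightarrow> (z, w) \<in> E \<longleftrightarrow> w = a \<or> w = b"
    using V(4) by blast
  then have z': "\<And>w. w \<in> V \<Longrightarrow> (w, z) \<in> E \<longleftrightarrow> w = a \<or> w = b"
    using sym_E by blast
  have "{(u, w) \<in> E. u \<in> insert z V \<and> w \<in> insert z V \<and> prec u w} =
      insert (e a) (insert (e b) {(u, w) \<in> E. u \<in> V \<and> w \<in> V \<and> prec u w})" (is "?L = ?R")
  proof (rule set_eqI)
    fix x :: "'a \<times> 'a"
    obtain u w where x: "x = (u, w)" by (cases x)
    have "x \<in> ?L \<longleftrightarrow> (u, w) \<in> E \<and> prec u w \<and>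
        (u \<in> V \<and> w \<in> V \<or> u = z \<and> w \<in> V \<or> w = z \<and> u \<in> V)"
      using irrefl_E x by blast
    also have "\<dots> \<longleftrightarrow> (u, w) \<in> E \<and> prec u w \<and> u \<in> V \<and> w \<in> V \<or>
        u = z \<and> (w = a \<or> w = b) \<and> prec z w \<or> w = z \<and> (u = a \<or> u = b) \<and> prec u z"
      using z z' zab by blast
    also have "\<dots> \<longleftrightarrow> x \<in> ?R"
      using prec[OF zab(1)] prec[OF zab(2)] zab V(2) x by (auto simp: e_def)
    finally show "x \<in> ?L \<longleftrightarrow> x \<in> ?R" .
  qed
  moreover have "finite {(u, w) \<in> E. u \<in> V \<and> w \<in> V \<and> prec u w}"
    by (rule finite_subset[of _ "V \<times> V"]) (use V(1) in auto)
  moreover have "e a \<noteq> e b" "e a \<notin> {(u, w) \<in> E. u \<in> V \<and> w \<in> V \<and> prec u w}"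
      "e b \<notin> {(u, w) \<in> E. u \<in> V \<and> w \<in> V \<and> prec u w}"
    using V(2,3) zab by (auto simp: e_def)
  ultimately have "P (insert z V) = ?f (e a) * (?f (e b) * P V)"
    by (simp add: orientation_poly_def)
  moreover have "?f (e c) = var z - var c \<or> ?f (e c) = - (var z - var c)" for c
    by (simp add: e_def)
  ultimately show ?thesis
    by (smt (verit) minus_mult_left minus_mult_right minus_minus)
qed

lemma orientation_poly_homogeneous:
  "two_tree E V \<Longrightarrow> homogeneous_on V (2 * card V - 3) (P V) \<and> 2 \<le> card V"
proof (induction rule: two_tree.induct)
  case (edge a b)
  then have ab: "a \<noteq> b" using irrefl_E by blast
  have "homogeneous_on {a, b} 0 1"
    by (auto simp: homogeneous_on_def lookup_one when_def split: if_splits)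
  then have "homogeneous_on {a, b} 1 (var u)" if "u \<in> {a, b}" for u
    using homogeneous_on_var_mult[of "{a, b}" 0 1 u] that by simp
  then have "homogeneous_on {a, b} 1 (var a - var b)"
    by (intro homogeneous_on_minus) auto
  then show ?case
    using orientation_poly_edge[OF edge] homogeneous_on_uminus[of _ _ "var a - var b"] ab by auto
next
  case (ear V a b z)
  have fin: "finite V" using ear.hyps(1) by (rule two_tree_finite)
  have ab: "a \<noteq> b" using ear.hyps(4) irrefl_E by blast
  have "homogeneous_on (insert z V) (2 * card V - 3) (P V)"
    using ear fin by (intro homogeneous_on_insert) auto
  then have "homogeneous_on (insert z V) (Suc (Suc (2 * card V - 3)))
      ((var z - var a) * ((var z - var b) * P V))"
    unfolding left_diff_distrib
    by (intro homogeneous_on_minus homogeneous_on_var_mult) (use ear fin in auto)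
  moreover have "Suc (Suc (2 * card V - 3)) = 2 * card (insert z V) - 3"
  proof -
    have "2 \<le> card V" using ear.IH by blast
    moreover have "card (insert z V) = Suc (card V)" using ear.hyps(5) fin by simp
    ultimately show ?thesis by linarith
  qed
  ultimately show ?case
    using orientation_poly_ear[OF fin ear.hyps(5) ab ear.hyps(6)]
      homogeneous_on_uminus[of _ _ "(var z - var a) * ((var z - var b) * P V)"] ear fin by auto
qed

end

lemma deficit_lower:
  assumes "finite V" "u \<in> V" "Poly_Mapping.lookup m u \<noteq> 0"
  shows "deficit V f (m - Poly_Mapping.single u 1) = deficit V f m + f u"
proof -
  have "(2 - int (Poly_Mapping.lookup (m - Poly_Mapping.single u 1) v)) * f v =
      (2 - int (Poly_Mapping.lookup m v)) * f v + (if v = u then f v else 0)" for v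
    using assms(3) by (auto simp: lookup_minus lookup_single when_def of_nat_diff algebra_simps)
  then show ?thesis
    using assms by (simp add: deficit_def sum.distrib)
qed

text \<open>
  The coefficient formula, with \<open>c\<close> as colouring.  The total deficit 3 is the one forced by the
  degree \<open>2 * card V - 3\<close> of the graph polynomial of a 2-tree.
\<close>
definition chi_law :: "'a set \<Rightarrow> ('a \<Rightarrow> int) \<Rightarrow> int \<Rightarrow> 'a mpoly_int \<Rightarrow> bool" where
  "chi_law V c s p \<longleftrightarrow>
     (\<forall>m. Poly_Mapping.keys m \<subseteq> V \<longrightarrow> (\<forall>v\<in>V. Poly_Mapping.lookup m v \<le> 2) \<longrightarrow>
        deficit V (\<lambda>_. 1) m = 3 \<longrightarrow> Poly_Mapping.lookup p m = s * chi (deficit V c m))"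

lemma keys_lower: "Poly_Mapping.keys (m - Poly_Mapping.single u (k::nat)) \<subseteq> Poly_Mapping.keys m"
  by (auto simp: in_keys_iff lookup_minus)

lemma lookup_lower_le: "Poly_Mapping.lookup (m - q) v \<le> (Poly_Mapping.lookup m v :: nat)"
  by (simp add: lookup_minus)

text \<open>
  Multiplying by the variable \<open>u\<close> lowers the exponent of \<open>u\<close> and so raises its deficit by one.
  If the exponent is already 0, the coefficient is 0; then \<open>u\<close> carries the whole deficit 2 and
  the argument of \<open>chi\<close> is \<open>3 * c u\<close>, so the formula still holds.
\<close>
lemma chi_law_lower:
  assumes law: "chi_law V c s p" and fin: "finite V" and u: "u \<in> V"
    and m: "Poly_Mapping.keys m \<subseteq> V" "\<And>v. v \<in> V \<Longrightarrow> Poly_Mapping.lookup m v \<le> 2"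
      "deficit V (\<lambda>_. 1) m = 2"
  shows "Poly_Mapping.lookup (var u * p) m = s * chi (deficit V c m + c u)"
proof (cases "Poly_Mapping.lookup m u = 0")
  case True
  have "deficit V (\<lambda>_. 1) m = 2 + (\<Sum>v\<in>V - {u}. 2 - int (Poly_Mapping.lookup m v))"
    using fin u True by (simp add: deficit_def sum.remove)
  then have "(\<Sum>v\<in>V - {u}. 2 - int (Poly_Mapping.lookup m v)) = 0" using m(3) by simp
  then have "\<forall>v\<in>V - {u}. 2 - int (Poly_Mapping.lookup m v) = 0"
    using fin m(2) by (subst (asm) sum_nonneg_eq_0_iff) force+
  then have "deficit V c m = 2 * c u"
    using fin u True by (simp add: deficit_def sum.remove)
  then have "chi (deficit V c m + c u) = 0" by (simp add: chi_eq_0_iff)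
  with True show ?thesis by (simp add: lookup_var_mult)
next
  case False
  let ?m = "m - Poly_Mapping.single u 1"
  have "Poly_Mapping.lookup p ?m = s * chi (deficit V c ?m)"
    using law[unfolded chi_law_def, rule_format, of ?m] keys_lower[of m u 1] m
      deficit_lower[OF fin u False, of "\<lambda>_. 1"]
      order_trans[OF lookup_lower_le[of m "Poly_Mapping.single u 1"] m(2)]
    by fastforce
  with False deficit_lower[OF fin u False, of c] show ?thesis
    by (simp add: lookup_var_mult)
qed

text \<open>
  With total deficit 1 the exponent of \<open>a\<close> is not 0, so lowering it stays in the scope of the
  formula.
\<close>
lemma chi_law_lower2:
  assumes law: "chi_law V c s p" and fin: "finite V" and ab: "a \<in> V" "b \<in> V"
    and m: "Poly_Mapping.keys m \<subseteq> V" "\<And>v. v \<in> V \<Longrightarrow> Poly_Mapping.lookup m v \<le> 2"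
      "deficit V (\<lambda>_. 1) m = 1"
  shows "Poly_Mapping.lookup (var a * (var b * p)) m = s * chi (deficit V c m + c a + c b)"
proof -
  have "deficit V (\<lambda>_. 1) m =
      2 - int (Poly_Mapping.lookup m a) + (\<Sum>v\<in>V - {a}. 2 - int (Poly_Mapping.lookup m v))"
    using fin ab by (simp add: deficit_def sum.remove)
  moreover have "(\<Sum>v\<in>V - {a}. 2 - int (Poly_Mapping.lookup m v)) \<ge> 0"
    using m(2) by (intro sum_nonneg) force
  ultimately have a: "Poly_Mapping.lookup m a \<noteq> 0" using m(3) by linarith
  let ?m = "m - Poly_Mapping.single a 1"
  have "Poly_Mapping.lookup (var b * p) ?m = s * chi (deficit V c ?m + c b)"
    using keys_lower[of m a 1] m deficit_lower[OF fin ab(1) a, of "\<lambda>_. 1"]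
      order_trans[OF lookup_lower_le[of m "Poly_Mapping.single a 1"] m(2)]
    by (intro chi_law_lower[OF law fin ab(2)]) auto
  with a deficit_lower[OF fin ab(1) a, of c] show ?thesis
    by (simp add: lookup_var_mult)
qed

text \<open>
  Expand \<open>(z - a) (z - b) = z\<^sup>2 - (a + b) z + a b\<close> and compare by the exponent of \<open>z\<close>.
  Exponent 2 picks \<open>p\<close> itself.  Exponent 1 shifts the argument of \<open>chi\<close> by \<open>c a\<close> and by \<open>c b\<close>,
  and the negated sum of the two values is the value for the shift \<open>c z\<close>.  Exponent 0 shifts it
  by \<open>c a + c b\<close>, which is \<open>2 * c z\<close> modulo 3 because the three colours add up to 6.
\<close>
lemma chi_law_ear:
  assumes law: "chi_law V c s p" and hom: "homogeneous_on V k p" and fin: "finite V"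
    and z: "z \<notin> V" and ab: "a \<in> V" "b \<in> V"
    and col: "c a \<in> {1,2,3}" "c b \<in> {1,2,3}" "c z \<in> {1,2,3}" "c a \<noteq> c b" "c a \<noteq> c z" "c b \<noteq> c z"
  shows "chi_law (insert z V) c s ((var z - var a) * ((var z - var b) * p))"
  unfolding chi_law_def
proof (intro allI impI)
  fix m :: "'a \<Rightarrow>\<^sub>0 nat"
  assume m: "Poly_Mapping.keys m \<subseteq> insert z V" "\<forall>v\<in>insert z V. Poly_Mapping.lookup m v \<le> 2"
    "deficit (insert z V) (\<lambda>_. 1) m = 3"
  define k where "k = Poly_Mapping.lookup m z"
  define m' where "m' = m - Poly_Mapping.single z k"
  have za: "z \<noteq> a" "z \<noteq> b" using z ab by auto
  have lk: "Poly_Mapping.lookup m' v = (if v = z then 0 else Poly_Mapping.lookup m v)" for v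
    by (simp add: m'_def lookup_minus lookup_single when_def k_def)
  have m': "Poly_Mapping.keys m' \<subseteq> V"
  proof
    fix x assume "x \<in> Poly_Mapping.keys m'"
    then have "x \<noteq> z" "x \<in> Poly_Mapping.keys m" by (auto simp: in_keys_iff lk split: if_splits)
    with m(1) show "x \<in> V" by blast
  qed
  have m'_le: "Poly_Mapping.lookup m' v \<le> 2" if "v \<in> V" for v
    using m(2) that by (simp add: lk)
  have def: "deficit (insert z V) f m = (2 - int k) * f z + deficit V f m'" for f
  proof -
    have "deficit V f m' = deficit V f m"
      unfolding deficit_def using z by (intro sum.cong) (auto simp: lk)
    then show ?thesis using z fin by (simp add: deficit_def k_def)
  qed
  have d1: "deficit V (\<lambda>_. 1) m' = 1 + int k" using m(3) def[of "\<lambda>_. 1"] by simp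
  have vanish: "Poly_Mapping.lookup p q = 0" if "Poly_Mapping.lookup q z \<noteq> 0" for q
    using hom that z unfolding homogeneous_on_def by (meson in_keys_iff subsetD)
  have expand: "(var z - var a) * ((var z - var b) * p) =
      var z * (var z * p) - var a * (var z * p) - var b * (var z * p) + var a * (var b * p)"
    by (simp add: algebra_simps)
  have k2: "k \<le> 2" using m(2) by (simp add: k_def)
  have zp: "Poly_Mapping.lookup (var u * (var z * p)) m =
      (if k = 1 then Poly_Mapping.lookup (var u * p) m' else 0)" if "u \<in> {a, b}" for u
  proof (cases "k = 1")
    case True
    then have "m - Poly_Mapping.single u 1 - Poly_Mapping.single z 1 = m' - Poly_Mapping.single u 1"
      by (simp add: m'_def diff_diff_add add.commute)
    then show ?thesis
      using True za that by (auto simp: lookup_var_mult lookup_minus lookup_single when_def k_def lk)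
  next
    case False
    then show ?thesis
      using za that vanish
      by (auto simp: lookup_var_mult lookup_minus lookup_single when_def k_def)
  qed
  have ab0: "Poly_Mapping.lookup (var a * (var b * p)) m = 0" if "k \<noteq> 0"
    using za that vanish by (auto simp: lookup_var_mult lookup_minus lookup_single when_def k_def)
  have zz: "Poly_Mapping.lookup (var z * (var z * p)) m = (if k = 2 then Poly_Mapping.lookup p m' else 0)"
  proof (cases "k = 2")
    case True
    have "m - Poly_Mapping.single z 1 - Poly_Mapping.single z 1 = m'"
      using True by (simp add: m'_def diff_diff_add single_add[symmetric] numeral_2_eq_2)
    then show ?thesis using True by (simp add: lookup_var_mult lookup_minus k_def)
  next
    case False
    then show ?thesis using k2 by (auto simp: lookup_var_mult lookup_minus k_def)
  qed
  have main: "Poly_Mapping.lookup ((var z - var a) * ((var z - var b) * p)) m =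
      (if k = 2 then Poly_Mapping.lookup p m' else 0) -
      (if k = 1 then Poly_Mapping.lookup (var a * p) m' else 0) -
      (if k = 1 then Poly_Mapping.lookup (var b * p) m' else 0) +
      Poly_Mapping.lookup (var a * (var b * p)) m"
    unfolding expand lookup_add lookup_minus by (simp only: zp zz insert_iff simp_thms)
  consider "k = 0" | "k = 1" | "k = 2" using k2 by linarith
  then show "Poly_Mapping.lookup ((var z - var a) * ((var z - var b) * p)) m =
      s * chi (deficit (insert z V) c m)"
  proof cases
    case 1
    then have "m' = m" by (simp add: m'_def)
    have "Poly_Mapping.lookup (var a * (var b * p)) m = s * chi (deficit V c m' + c a + c b)"
      using chi_law_lower2[OF law fin ab m' m'_le] d1 1 \<open>m' = m\<close> by simp
    also have "chi (deficit V c m' + c a + c b) = chi (2 * c z + deficit V c m')"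
    proof (rule chi_cong)
      have "c a + c b + c z = 6" using col by auto
      then have "deficit V c m' + c a + c b = 2 * c z + deficit V c m' + 3 * (2 - c z)" by simp
      then show "(deficit V c m' + c a + c b) mod 3 = (2 * c z + deficit V c m') mod 3"
        by (metis mod_mult_self2)
    qed
    finally show ?thesis
      unfolding main using 1 by (simp add: def)
  next
    case 2
    have "Poly_Mapping.lookup (var u * p) m' = s * chi (deficit V c m' + c u)" if "u \<in> V" for u
      using chi_law_lower[OF law fin that m' m'_le] d1 2 by simp
    moreover have "chi (deficit V c m' + c z) =
        - chi (deficit V c m' + c a) - chi (deficit V c m' + c b)"
      using chi_three[OF col, of "deficit V c m'"] by linarith
    moreover have "deficit (insert z V) c m = deficit V c m' + c z"
      using 2 by (simp add: def)
    ultimately show ?thesis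
      unfolding main using 2 ab ab0 by (simp add: right_diff_distrib)
  next
    case 3
    have "Poly_Mapping.lookup p m' = s * chi (deficit V c m')"
      using law m' m'_le d1 3 by (simp add: chi_law_def)
    then show ?thesis
      unfolding main using 3 ab0 by (simp add: def)
  qed
qed

lemma chi_law_edge:
  assumes ab: "a \<noteq> b" and col: "c a \<in> {1,2,3}" "c b \<in> {1,2,3}" "c a \<noteq> c b"
  shows "chi_law {a, b} c (chi (c a - c b)) (var a - var b)"
  unfolding chi_law_def
proof (intro allI impI)
  fix m :: "'a \<Rightarrow>\<^sub>0 nat"
  assume keys: "Poly_Mapping.keys m \<subseteq> {a, b}" and d: "deficit {a, b} (\<lambda>_. 1) m = 3"
  have lookup_var: "Poly_Mapping.lookup (var u) m = (if m = Poly_Mapping.single u 1 then 1 else 0)" for u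
    by (auto simp: var_def lookup_single when_def)
  have other: "Poly_Mapping.lookup m v = 0" if "v \<noteq> a" "v \<noteq> b" for v
    using keys that by (meson in_keys_iff insertE singletonD subsetD)
  have "Poly_Mapping.lookup m a + Poly_Mapping.lookup m b = 1"
    using d ab by (simp add: deficit_def)
  then consider "Poly_Mapping.lookup m a = 1" "Poly_Mapping.lookup m b = 0"
    | "Poly_Mapping.lookup m a = 0" "Poly_Mapping.lookup m b = 1"
    by linarith
  then show "Poly_Mapping.lookup (var a - var b) m = chi (c a - c b) * chi (deficit {a, b} c m)"
  proof cases
    case 1
    have "m = Poly_Mapping.single a 1"
    proof (rule poly_mapping_eqI)
      show "Poly_Mapping.lookup m k = Poly_Mapping.lookup (Poly_Mapping.single a 1) k" for k
        using 1 other[of k] by (cases "k = a"; cases "k = b") (auto simp: lookup_single when_def)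
    qed
    moreover have "m \<noteq> Poly_Mapping.single b 1" using 1 by auto
    ultimately have "Poly_Mapping.lookup (var a - var b) m = 1"
      unfolding lookup_minus lookup_var by simp
    moreover have "deficit {a, b} c m = c a + 2 * c b" using 1 ab by (simp add: deficit_def)
    ultimately show ?thesis using col by (auto simp: chi_def)
  next
    case 2
    have "m = Poly_Mapping.single b 1"
    proof (rule poly_mapping_eqI)
      show "Poly_Mapping.lookup m k = Poly_Mapping.lookup (Poly_Mapping.single b 1) k" for k
        using 2 other[of k] by (cases "k = a"; cases "k = b") (auto simp: lookup_single when_def)
    qed
    moreover have "m \<noteq> Poly_Mapping.single a 1" using 2 by auto
    ultimately have "Poly_Mapping.lookup (var a - var b) m = -1"
      unfolding lookup_minus lookup_var by simp
    moreover have "deficit {a, b} c m = 2 * c a + c b" using 2 ab by (simp add: deficit_def)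
    ultimately show ?thesis using col by (auto simp: chi_def)
  qed
qed

lemma chi_law_uminus: "chi_law V c s p \<Longrightarrow> chi_law V c (- s) (- p)"
  by (simp add: chi_law_def)

context oriented_graph
begin

theorem coefficient_two_tree:
  assumes "two_tree E V"
    and "\<And>v. v \<in> V \<Longrightarrow> c v \<in> {1, 2, 3}"
    and "\<And>u w. u \<in> V \<Longrightarrow> w \<in> V \<Longrightarrow> (u, w) \<in> E \<Longrightarrow> c u \<noteq> c w"
  obtains s where "s \<noteq> 0" "chi_law V c s (P V)"
proof -
  have "\<exists>s. s \<noteq> 0 \<and> chi_law V c s (P V)"
    using assms
  proof (induction rule: two_tree.induct)
    case (edge a b)
    have ab: "a \<noteq> b" using edge.hyps irrefl_E by blast
    have col: "c a \<in> {1,2,3}" "c b \<in> {1,2,3}" "c a \<noteq> c b" using edge by auto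
    have law: "chi_law {a, b} c (chi (c a - c b)) (var a - var b)"
      using chi_law_edge[OF ab col] .
    have "chi (c a - c b) \<noteq> 0" using col by (auto simp: chi_def)
    then show ?case
      using orientation_poly_edge[OF edge.hyps] law chi_law_uminus[OF law]
      by (metis minus_minus neg_equal_0_iff_equal)
  next
    case (ear V a b z)
    have fin: "finite V" using ear.hyps(1) by (rule two_tree_finite)
    have ab: "a \<noteq> b" using ear.hyps(4) irrefl_E by blast
    have zab: "(z, a) \<in> E" "(z, b) \<in> E" using ear.hyps(6) by blast+
    have "\<exists>s. s \<noteq> 0 \<and> chi_law V c s (P V)"
      by (rule ear.IH) (use ear.prems in auto)
    then obtain s where s: "s \<noteq> 0" "chi_law V c s (P V)" by (elim exE conjE)
    have hom: "homogeneous_on V (2 * card V - 3) (P V)"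
      using orientation_poly_homogeneous[OF ear.hyps(1)] by blast
    have law: "chi_law (insert z V) c s ((var z - var a) * ((var z - var b) * P V))"
      using ear.hyps ear.prems(1) ear.prems(2)[of a b] ear.prems(2)[of z a] ear.prems(2)[of z b] zab
      by (intro chi_law_ear[OF s(2) hom fin ear.hyps(5,2,3)]) auto
    then show ?case
      using orientation_poly_ear[OF fin ear.hyps(5) ab ear.hyps(6)] s(1) chi_law_uminus[OF law]
      by (metis neg_equal_0_iff_equal)
  qed
  then obtain s where "s \<noteq> 0" "chi_law V c s (P V)" by (elim exE conjE)
  then show ?thesis by (rule that)
qed

end

section \<open>Outerplane near-triangulations\<close>

locale plane =
  fixes G :: "'a pair_pre_digraph" and pos :: "'a \<Rightarrow> complex"
    and crv :: "'a \<times> 'a \<Rightarrow> real \<Rightarrow> complex"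
  assumes plane: "plane_graph G pos crv"
begin

abbreviation "E \<equiv> parcs G"
abbreviation "V \<equiv> pverts G"
abbreviation "D \<equiv> drawing G pos crv"
abbreviation "curve u w \<equiv> path_image (crv (u, w))"

lemma pair_graph: "pair_graph G"
  using plane by (simp add: plane_graph_def)

sublocale adjacency E
proof
  interpret pair_graph G by (rule pair_graph)
  show "(w, u) \<in> E" if "(u, w) \<in> E" for u w
    using that graph_symmetric by simp
  show "(u, u) \<notin> E" for u
    using pair_no_loops[of "(u, u)"] by auto
qed

lemma edge_in_V: "(u, w) \<in> E \<Longrightarrow> u \<in> V \<and> w \<in> V"
proof -
  interpret pair_graph G by (rule pair_graph)
  show "(u, w) \<in> E \<Longrightarrow> u \<in> V \<and> w \<in> V" by (auto dest: in_arcsD1 in_arcsD2)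
qed

lemma finite_V: "finite V"
proof -
  interpret pair_graph G by (rule pair_graph)
  show ?thesis by (rule pair_finite_verts)
qed

lemma pos_eq_iff: "u \<in> V \<Longrightarrow> w \<in> V \<Longrightarrow> pos u = pos w \<longleftrightarrow> u = w"
  using plane by (auto simp: plane_graph_def inj_on_def)

lemma curve:
  assumes "(u, w) \<in> E"
  shows "arc (crv (u, w))" "pathstart (crv (u, w)) = pos u" "pathfinish (crv (u, w)) = pos w"
    "curve u w \<inter> pos ` V = {pos u, pos w}"
  using plane assms unfolding plane_graph_def by fast+

lemma curve_commute: "(u, w) \<in> E \<Longrightarrow> curve w u = curve u w"
  using plane unfolding plane_graph_def by fast

lemma ends_in_curve: "(u, w) \<in> E \<Longrightarrow> pos u \<in> curve u w \<and> pos w \<in> curve u w"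
  using curve(4) by blast

lemma vertex_in_curve: "(u, w) \<in> E \<Longrightarrow> v \<in> V \<Longrightarrow> pos v \<in> curve u w \<longleftrightarrow> v = u \<or> v = w"
  using curve(4)[of u w] pos_eq_iff[of v u] pos_eq_iff[of v w] edge_in_V[of u w] by blast

lemma curves_meet:
  assumes "(u, w) \<in> E" "(u', w') \<in> E" "{u, w} \<noteq> {u', w'}" "p \<in> curve u w" "p \<in> curve u' w'"
  obtains v where "v \<in> {u, w} \<inter> {u', w'}" "p = pos v"
proof -
  have "p \<in> pos ` V"
    using plane assms unfolding plane_graph_def by fast
  then obtain v where v: "v \<in> V" "p = pos v" by blast
  with assms that[of v] show ?thesis by (auto simp: vertex_in_curve)
qed

lemma curve_subset_drawing: "(u, w) \<in> E \<Longrightarrow> curve u w \<subseteq> D"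
  by (auto simp: drawing_def)

lemma path_arc:
  assumes "distinct xs" "length xs \<ge> 2" "set (zip xs (tl xs)) \<subseteq> E"
  obtains g where "arc g" "pathstart g = pos (hd xs)" "pathfinish g = pos (last xs)"
    "path_image g = (\<Union>e \<in> set (zip xs (tl xs)). path_image (crv e))"
proof -
  have "\<exists>g. arc g \<and> pathstart g = pos (hd xs) \<and> pathfinish g = pos (last xs) \<and>
    path_image g = (\<Union>e \<in> set (zip xs (tl xs)). path_image (crv e))"
    using assms
  proof (induction xs)
    case Nil
    then show ?case by simp
  next
    case (Cons x ys)
    then obtain y zs where ys: "ys = y # zs" by (cases ys) auto
    have xy: "(x, y) \<in> E" using Cons.prems by (simp add: ys)
    show ?case
    proof (cases zs)
      case Nil
      then show ?thesis
        using curve[OF xy] by (intro exI[of _ "crv (x, y)"]) (auto simp: ys)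
    next
      case (Cons z zs')
      then obtain g where g: "arc g" "pathstart g = pos y" "pathfinish g = pos (last ys)"
          "path_image g = (\<Union>e \<in> set (zip ys zs). path_image (crv e))"
        using Cons.IH Cons.prems by (auto simp: ys)
      have "curve x y \<inter> path_image g \<subseteq> {pos y}"
      proof
        fix p assume "p \<in> curve x y \<inter> path_image g"
        then obtain u w where p: "p \<in> curve x y" "(u, w) \<in> set (zip ys zs)" "p \<in> curve u w"
          using g(4) by auto
        then have uw: "u \<in> set ys" "w \<in> set ys" "(u, w) \<in> E"
          using Cons.prems by (auto simp: ys dest: set_zip_leftD set_zip_rightD)
        then have "x \<noteq> u" "x \<noteq> w" using Cons.prems(1) by auto
        then have "{x, y} \<noteq> {u, w}" by auto
        then obtain v where "v \<in> {x, y} \<inter> {u, w}" "p = pos v"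
          using curves_meet[OF xy uw(3) _ p(1,3)] by metis
        with \<open>x \<noteq> u\<close> \<open>x \<noteq> w\<close> show "p \<in> {pos y}" by auto
      qed
      then have "arc (crv (x, y) +++ g)"
        using curve[OF xy] g by (intro arc_join) auto
      then show ?thesis
        using curve[OF xy] g
        by (intro exI[of _ "crv (x, y) +++ g"]) (auto simp: ys path_image_join)
    qed
  qed
  with that show ?thesis by blast
qed

text \<open>
  The cycle through \<open>a\<close> and then along \<open>xs\<close>, each edge taken in the direction of travel.
\<close>
definition cycle_edges :: "'a \<Rightarrow> 'a list \<Rightarrow> ('a \<times> 'a) set" where
  "cycle_edges a xs = insert (last xs, a) (set (zip (a # xs) xs))"

lemma cycle_curve:
  assumes "distinct (a # xs)" "length xs \<ge> 2" "cycle_edges a xs \<subseteq> E"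
  obtains g where "simple_path g" "pathfinish g = pathstart g"
    "path_image g = (\<Union>e \<in> cycle_edges a xs. path_image (crv e))"
proof -
  have F: "set (zip (a # xs) xs) \<subseteq> E" and la: "(last xs, a) \<in> E"
    using assms(3) by (auto simp: cycle_edges_def)
  obtain g where g: "arc g" "pathstart g = pos a" "pathfinish g = pos (last (a # xs))"
      "path_image g = (\<Union>e \<in> set (zip (a # xs) xs). path_image (crv e))"
    using path_arc[of "a # xs"] assms(1,2) F by auto
  obtain b c ys where xs: "xs = b # c # ys" using assms(2) by (cases xs; cases "tl xs") auto
  have "path_image g \<inter> curve (last xs) a \<subseteq> {pos a, pos (last xs)}"
  proof
    fix p assume "p \<in> path_image g \<inter> curve (last xs) a"
    then obtain u w where p: "p \<in> curve (last xs) a" "(u, w) \<in> set (zip (a # xs) xs)" "p \<in> curve u w"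
      using g(4) by auto
    \<comment> \<open>The closing edge is not already on the path, because the path has at least three vertices.\<close>
    have "{u, w} \<noteq> {last xs, a}"
    proof
      assume eq: "{u, w} = {last xs, a}"
      have "w \<in> set xs" using p(2) by (rule set_zip_rightD)
      then have "u = a" "w = last xs" using assms(1) eq by (auto simp: doubleton_eq_iff)
      then have "last xs = b"
        using p(2) assms(1) by (auto simp: xs dest: set_zip_leftD)
      with assms(1) show False by (auto simp: xs split: if_splits)
    qed
    with la p F show "p \<in> {pos a, pos (last xs)}"
      by (elim curves_meet[of "last xs" a u w]) auto
  qed
  then have "simple_path (g +++ crv (last xs, a))"
    using curve[OF la] g xs by (intro simple_path_join_loop) auto
  with that[of "g +++ crv (last xs, a)"] show ?thesis
    using curve[OF la] g xs by (auto simp: path_image_join cycle_edges_def)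
qed

lemma set_cycle_edges:
  assumes "(u, w) \<in> cycle_edges a xs" "xs \<noteq> []"
  shows "u \<in> set (a # xs) \<and> w \<in> set (a # xs)"
  using assms by (auto simp: cycle_edges_def dest: set_zip_leftD set_zip_rightD)

end

locale outerplane = plane +
  assumes outer: "outerplane_graph G pos crv"
begin

lemma outside_touches_vertices:
  assumes "v \<in> V"
  shows "pos v \<in> closure (outside D)"
  using outer assms by (auto simp: outerplane_graph_def outer_face_def frontier_def)

text \<open>
  Every vertex is a limit of points of the outer face, so none lies in the open inside of the
  curve.  An edge that enters the inside can only leave it at one of its ends, so both ends lie
  on the curve and the edge is a chord.
\<close>
lemma inside_empty:
  assumes g: "simple_path g" "pathfinish g = pathstart g"
    and img: "path_image g = (\<Union>e \<in> F. path_image (crv e))" and F: "F \<subseteq> E"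
    and induced: "\<And>u w. (u, w) \<in> E \<Longrightarrow> pos u \<in> path_image g \<Longrightarrow> pos w \<in> path_image g \<Longrightarrow>
        (u, w) \<in> F \<or> (w, u) \<in> F"
  shows "inside (path_image g) \<inter> D = {}"
proof -
  note J = Jordan_inside_outside[OF g]
  let ?I = "inside (path_image g)"
  have ZD: "path_image g \<subseteq> D" using img F by (auto simp: drawing_def)
  have no_vertex: "pos v \<notin> ?I" if "v \<in> V" for v
  proof
    assume I: "pos v \<in> ?I"
    have "?I \<inter> outside D = {}" using J outside_mono[OF ZD] by blast
    then have "?I \<inter> closure (outside D) = {}"
      using J by (simp add: open_Int_closure_eq_empty)
    with I outside_touches_vertices[OF that] show False by blast
  qed
  have no_edge: "curve u w \<inter> ?I = {}" if uw: "(u, w) \<in> E" for u w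
  proof (rule ccontr)
    assume "curve u w \<inter> ?I \<noteq> {}"
    then obtain q where q: "q \<in> curve u w" "q \<in> ?I" by blast
    let ?S = "curve u w - {pos u, pos w}"
    have notF: "(u, w) \<notin> F \<and> (w, u) \<notin> F"
    proof -
      have "curve u w \<subseteq> path_image g" if "(u, w) \<in> F \<or> (w, u) \<in> F"
        using that img curve_commute[OF uw] by blast
      then show ?thesis using q J by blast
    qed
    have "?S \<inter> path_image g = {}"
    proof (rule ccontr)
      assume "?S \<inter> path_image g \<noteq> {}"
      then obtain p u' w' where p: "p \<in> ?S" "(u', w') \<in> F" "p \<in> curve u' w'"
        using img by auto
      have "{u, w} \<noteq> {u', w'}" using notF p(2) by (auto simp: doubleton_eq_iff)
      with uw p F show False by (elim curves_meet[of u w u' w' p]) auto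
    qed
    moreover have "topological_space_class.connected ?S"
      using connected_simple_path_endless[OF arc_imp_simple_path[OF curve(1)[OF uw]]] curve[OF uw]
      by simp
    moreover have "q \<in> ?S \<inter> ?I" using q no_vertex edge_in_V[OF uw] by auto
    ultimately have SI: "?S \<subseteq> ?I"
      using connected_Int_frontier[of ?S ?I] J by blast
    have "?S = crv (u, w) ` {0<..<1}"
      using simple_path_endless[OF arc_imp_simple_path[OF curve(1)[OF uw]]] curve[OF uw] by simp
    then have "crv (u, w) ` closure {0<..<1} \<subseteq> closure ?I"
      using SI closure_subset[of ?I] arc_imp_path[OF curve(1)[OF uw]]
      by (intro image_closure_subset) (auto simp: path_def)
    then have "curve u w \<subseteq> closure ?I" by (simp add: path_image_def)
    then have "pos u \<in> closure ?I" "pos w \<in> closure ?I" using ends_in_curve[OF uw] by blast+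
    moreover have "closure ?I = ?I \<union> path_image g"
      using J by (metis closure_Un_frontier)
    ultimately have "pos u \<in> path_image g" "pos w \<in> path_image g"
      using no_vertex edge_in_V[OF uw] by blast+
    with induced[OF uw] notF show False by blast
  qed
  show ?thesis
    using no_vertex no_edge by (auto simp: drawing_def)
qed

text \<open>
  A connected set that properly extends the inside meets its frontier, which is drawn.
\<close>
lemma inside_face:
  assumes g: "simple_path g" "pathfinish g = pathstart g"
    and sub: "path_image g \<subseteq> D" and empty: "inside (path_image g) \<inter> D = {}"
  shows "inside (path_image g) \<in> faces G pos crv"
proof -
  note J = Jordan_inside_outside[OF g]
  let ?I = "inside (path_image g)"
  have "S = ?I" if "?I \<subseteq> S" "S \<subseteq> - D" "topological_space_class.connected S" for S
  proof (rule ccontr)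
    assume "S \<noteq> ?I"
    then have "S \<inter> frontier ?I \<noteq> {}"
      using that J by (intro connected_Int_frontier) auto
    moreover have "frontier ?I = path_image g" using J by simp
    ultimately show False using that(2) sub by auto
  qed
  moreover have "?I \<noteq> {}" "topological_space_class.connected ?I" using J by simp_all
  moreover have "?I \<subseteq> - D" using empty by auto
  ultimately show ?thesis
    unfolding faces_def in_components_maximal by simp
qed

end

locale outerplane_near_triangulation = outerplane +
  assumes near_triangulation: "near_triangulation G pos crv"
begin

text \<open>
  The inside of an induced cycle is a bounded face, hence bounded by a triangle, and all
  vertices of the cycle lie on this triangle.
\<close>
lemma induced_cycle_triangle:
  assumes xs: "distinct (a # xs)" "length xs \<ge> 2" "cycle_edges a xs \<subseteq> E"
    and induced: "\<And>u w. (u, w) \<in> E \<Longrightarrow> u \<in> set (a # xs) \<Longrightarrow> w \<in> set (a # xs) \<Longrightarrow>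
        (u, w) \<in> cycle_edges a xs \<or> (w, u) \<in> cycle_edges a xs"
  shows "length xs \<le> 2"
    and "\<exists>g. simple_path g \<and> pathfinish g = pathstart g \<and>
           path_image g = (\<Union>e \<in> cycle_edges a xs. path_image (crv e)) \<and>
           inside (path_image g) \<in> faces G pos crv"
proof -
  obtain g where g: "simple_path g" "pathfinish g = pathstart g"
    "path_image g = (\<Union>e \<in> cycle_edges a xs. path_image (crv e))"
    using cycle_curve[OF xs] .
  note J = Jordan_inside_outside[OF g(1,2)]
  let ?I = "inside (path_image g)"
  have ne: "xs \<noteq> []" using xs(2) by auto
  have on_cycle: "v \<in> set (a # xs)" if v: "v \<in> V" "pos v \<in> path_image g" for v
  proof -
    obtain u w where uw: "(u, w) \<in> cycle_edges a xs" "pos v \<in> curve u w"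
      using v(2) g(3) by auto
    with xs(3) v(1) have "v = u \<or> v = w" by (auto simp: vertex_in_curve)
    with set_cycle_edges[OF uw(1) ne] show ?thesis by blast
  qed
  have ZD: "path_image g \<subseteq> D" using g(3) xs(3) by (auto simp: drawing_def)
  have empty: "?I \<inter> D = {}"
    using induced on_cycle edge_in_V by (intro inside_empty[OF g xs(3)]) blast
  have face: "?I \<in> faces G pos crv"
    using inside_face[OF g(1,2) ZD empty] .
  then show "\<exists>g. simple_path g \<and> pathfinish g = pathstart g \<and>
      path_image g = (\<Union>e \<in> cycle_edges a xs. path_image (crv e)) \<and>
      inside (path_image g) \<in> faces G pos crv"
    using g by blast
  have "?I \<noteq> outer_face G pos crv"
  proof -
    have "?I \<inter> outside (path_image g) = {}" "?I \<noteq> {}" using J by simp_all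
    with outside_mono[OF ZD] show ?thesis unfolding outer_face_def by blast
  qed
  then have "triangular_face G crv ?I"
    using near_triangulation face by (simp add: near_triangulation_def)
  then obtain p q r where pqr: "(p, q) \<in> E" "(q, r) \<in> E" "(r, p) \<in> E"
      "path_image g = curve p q \<union> curve q r \<union> curve r p"
    using J by (auto simp: triangular_face_def)
  have "set (a # xs) \<subseteq> {p, q, r}"
  proof
    fix v assume v: "v \<in> set (a # xs)"
    have "\<exists>e \<in> cycle_edges a xs. v = fst e \<or> v = snd e"
    proof -
      have "v = a \<or> (\<exists>i < length xs. v = xs ! i)" using v by (auto simp: in_set_conv_nth)
      moreover have "((a # xs) ! i, xs ! i) \<in> set (zip (a # xs) xs)" if "i < length xs" for i
        using that by (auto simp: in_set_zip)
      ultimately show ?thesis unfolding cycle_edges_def by force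
    qed
    then obtain u w where uw: "(u, w) \<in> cycle_edges a xs" "v = u \<or> v = w" by auto
    then have "(u, w) \<in> E" using xs(3) by blast
    then have "pos v \<in> path_image g" "v \<in> V"
      using uw g(3) ends_in_curve[of u w] edge_in_V[of u w] by blast+
    with pqr show "v \<in> {p, q, r}" by (auto simp: vertex_in_curve)
  qed
  then have "card (set (a # xs)) \<le> card {p, q, r}" by (intro card_mono) auto
  also have "\<dots> \<le> 3" by (simp add: card_insert_if)
  finally show "length xs \<le> 2" using xs(1) by (simp add: distinct_card)
qed

lemma chordal: "chordal_on E V"
  unfolding chordal_on_def
proof (intro allI impI)
  fix a xs
  assume a: "a \<in> V" "a \<notin> set xs" and xs: "set xs \<subseteq> V" "induced_path E xs"
    and ends: "(a, hd xs) \<in> E" "(a, last xs) \<in> E"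
    and no: "\<forall>i. 0 < i \<longrightarrow> Suc i < length xs \<longrightarrow> (a, xs ! i) \<notin> E"
  have ne: "xs \<noteq> []" and dist: "distinct xs"
    and adj: "\<And>i j. i < length xs \<Longrightarrow> j < length xs \<Longrightarrow> (xs ! i, xs ! j) \<in> E \<longleftrightarrow> i = Suc j \<or> j = Suc i"
    using xs(2) by (auto simp: induced_path_def)
  have consecutive: "(xs ! i, xs ! Suc i) \<in> cycle_edges a xs" if "Suc i < length xs" for i
  proof -
    have "(xs ! i, xs ! Suc i) = zip (a # xs) xs ! Suc i" using that by simp
    also have "\<dots> \<in> set (zip (a # xs) xs)" using that by (intro nth_mem) simp
    finally show ?thesis by (simp add: cycle_edges_def)
  qed
  have first: "(a, hd xs) \<in> cycle_edges a xs" and last: "(last xs, a) \<in> cycle_edges a xs"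
    using ne by (cases xs; auto simp: cycle_edges_def)+
  show "length xs \<le> 2"
  proof (cases "length xs \<ge> 2")
    case True
    show ?thesis
    proof (rule induced_cycle_triangle(1)[OF _ True])
      show "distinct (a # xs)" using a dist by simp
      have "zip (a # xs) xs ! i \<in> E" if "i < length xs" for i
        using that ends adj ne by (cases i) (auto simp: hd_conv_nth)
      then show "cycle_edges a xs \<subseteq> E"
        using ends sym_E by (auto simp: cycle_edges_def in_set_conv_nth)
    next
      have at_a: "(a, w) \<in> cycle_edges a xs \<or> (w, a) \<in> cycle_edges a xs"
        if w: "(a, w) \<in> E" "w \<in> set xs" for w
      proof -
        obtain i where i: "i < length xs" "w = xs ! i" using w(2) by (auto simp: in_set_conv_nth)
        with no w(1) have "i = 0 \<or> Suc i = length xs" by (metis Suc_lessI not_gr_zero)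
        then have "i = 0 \<or> i = length xs - 1" by linarith
        then have "w = hd xs \<or> w = last xs"
          using i ne by (auto simp: hd_conv_nth last_conv_nth)
        with first last show ?thesis by auto
      qed
      fix u w assume uw: "(u, w) \<in> E" "u \<in> set (a # xs)" "w \<in> set (a # xs)"
      consider "u = a" "w \<in> set xs" | "w = a" "u \<in> set xs" | "u \<in> set xs" "w \<in> set xs"
        using uw irrefl_E by auto
      then show "(u, w) \<in> cycle_edges a xs \<or> (w, u) \<in> cycle_edges a xs"
      proof cases
        case 1
        with uw at_a show ?thesis by blast
      next
        case 2
        with uw at_a sym_E show ?thesis by blast
      next
        case 3
        then obtain i j where "i < length xs" "u = xs ! i" "j < length xs" "w = xs ! j"
          by (auto simp: in_set_conv_nth)
        with adj uw(1) consecutive show ?thesis by auto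
      qed
    qed
  qed simp
qed

definition triangle :: "'a \<Rightarrow> 'a \<Rightarrow> 'a \<Rightarrow> complex set" where
  "triangle a b c = curve a b \<union> curve b c \<union> curve c a"

lemma triangle_curve:
  assumes "(a, b) \<in> E" "(b, c) \<in> E" "(c, a) \<in> E"
  obtains g where "simple_path g" "pathfinish g = pathstart g" "path_image g = triangle a b c"
    "inside (triangle a b c) \<in> faces G pos crv"
proof -
  have ce: "cycle_edges a [b, c] = {(c, a), (a, b), (b, c)}" by (simp add: cycle_edges_def)
  have "a \<noteq> b" "b \<noteq> c" "c \<noteq> a" using assms irrefl_E by auto
  then have "\<exists>g. simple_path g \<and> pathfinish g = pathstart g \<and>
           path_image g = (\<Union>e \<in> cycle_edges a [b, c]. path_image (crv e)) \<and>
           inside (path_image g) \<in> faces G pos crv"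
    using assms irrefl_E by (intro induced_cycle_triangle(2)) (auto simp: ce)
  then obtain g where "simple_path g" "pathfinish g = pathstart g"
      "path_image g = (\<Union>e \<in> cycle_edges a [b, c]. path_image (crv e))"
      "inside (path_image g) \<in> faces G pos crv" by blast
  moreover have "(\<Union>e \<in> cycle_edges a [b, c]. path_image (crv e)) = triangle a b c"
    by (auto simp: ce triangle_def)
  ultimately show ?thesis using that by metis
qed

text \<open>
  The insides of the triangles on four mutually adjacent vertices would be distinct faces.  So a
  point \<open>p\<close> inside \<open>abc\<close> and a point \<open>q\<close> of the outer face are not separated by any of
  \<open>abd\<close>, \<open>acd\<close>, \<open>bcd\<close>.  Two of these triangles meet in an edge, and their union meets the third
  in two adjacent edges; both intersections are connected, so by Janiszewski's theorem the union
  of all three does not separate \<open>p\<close> from \<open>q\<close> either.  But this union contains \<open>abc\<close>.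
\<close>
lemma K4_free: "K4_free_on E V"
  unfolding K4_free_on_def
proof (rule notI, elim bexE conjE)
  fix a b c d
  assume V: "a \<in> V" "b \<in> V" "c \<in> V" "d \<in> V"
    and e: "(a, b) \<in> E" "(a, c) \<in> E" "(a, d) \<in> E" "(b, c) \<in> E" "(b, d) \<in> E" "(c, d) \<in> E"
  note e' = e[THEN sym_E]
  have neq: "a \<noteq> b" "a \<noteq> c" "a \<noteq> d" "b \<noteq> c" "b \<noteq> d" "c \<noteq> d" using e irrefl_E by auto
  obtain g where g: "simple_path g" "pathfinish g = pathstart g" "path_image g = triangle a b c"
    "inside (triangle a b c) \<in> faces G pos crv"
    using triangle_curve[OF e(1,4) e'(2)] .
  note J = Jordan_inside_outside[OF g(1,2), unfolded g(3)]
  obtain p where p: "p \<in> inside (triangle a b c)" using J by blast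
  have "pos a \<in> closure (outside D)" using V(1) by (rule outside_touches_vertices)
  then have "outside D \<noteq> {}" by auto
  then obtain q where q: "q \<in> outside D" by blast
  have TD: "triangle u v w \<subseteq> D" if "(u, v) \<in> E" "(v, w) \<in> E" "(w, u) \<in> E" for u v w
    using that curve_subset_drawing by (auto simp: triangle_def)
  have pD: "p \<notin> D"
    using p g(4) in_components_subset unfolding faces_def by blast
  have not_d: "pos d \<notin> triangle a b c"
    using e e' V neq by (auto simp: triangle_def vertex_in_curve)
  have linked: "compact (triangle u v d) \<and> connected_component (- triangle u v d) p q"
    if uv: "(u, v) \<in> E" "(v, d) \<in> E" "(d, u) \<in> E" for u v
  proof -
    obtain h where h: "simple_path h" "pathfinish h = pathstart h" "path_image h = triangle u v d"
      "inside (triangle u v d) \<in> faces G pos crv"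
      using triangle_curve[OF uv] .
    note J' = Jordan_inside_outside[OF h(1,2), unfolded h(3)]
    have "p \<notin> inside (triangle u v d)"
    proof
      assume "p \<in> inside (triangle u v d)"
      then have "inside (triangle u v d) = inside (triangle a b c)"
        using p h(4) g(4) components_eq[of "inside (triangle u v d)" "- D" "inside (triangle a b c)"]
        unfolding faces_def by blast
      then have "triangle u v d = triangle a b c" using J J' by metis
      moreover have "pos d \<in> triangle u v d"
        using ends_in_curve[OF uv(2)] by (auto simp: triangle_def)
      ultimately show False using not_d by simp
    qed
    then have "p \<in> outside (triangle u v d)"
      using J' pD TD[OF uv] by blast
    moreover have "q \<in> outside (triangle u v d)"
      using q outside_mono[OF TD[OF uv]] by blast
    moreover have "outside (triangle u v d) \<subseteq> - triangle u v d" using J' by blast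
    ultimately have "connected_component (- triangle u v d) p q"
      using J' unfolding connected_component_def by blast
    moreover have "compact (triangle u v d)"
      using compact_simple_path_image[OF h(1)] h(3) by simp
    ultimately show ?thesis by blast
  qed
  note abd = linked[OF e(1,5) e'(3)] and acd = linked[OF e(2,6) e'(3)] and bcd = linked[OF e(4,6) e'(5)]
  have "connected_component (- (triangle a b d \<union> triangle a c d)) p q"
  proof (rule Janiszewski)
    have "triangle a b d \<inter> triangle a c d = curve d a"
    proof
      show "triangle a b d \<inter> triangle a c d \<subseteq> curve d a"
      proof
        fix s assume s: "s \<in> triangle a b d \<inter> triangle a c d"
        show "s \<in> curve d a"
        proof (rule ccontr)
          assume "s \<notin> curve d a"
          then obtain x y x' y' where *: "(x, y) \<in> {(a, b), (b, d)}" "(x', y') \<in> {(a, c), (c, d)}"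
              "s \<in> curve x y" "s \<in> curve x' y'"
            using s by (auto simp: triangle_def)
          then have "(x, y) \<in> E" "(x', y') \<in> E" "{x, y} \<noteq> {x', y'}"
            using e neq by (auto simp: doubleton_eq_iff)
          then obtain v where "v \<in> {x, y} \<inter> {x', y'}" "s = pos v"
            using *(3,4) by (rule curves_meet)
          then have "s \<in> {pos a, pos d}" using *(1,2) neq by auto
          with \<open>s \<notin> curve d a\<close> ends_in_curve[OF e'(3)] show False by auto
        qed
      qed
    qed (auto simp: triangle_def)
    then show "topological_space_class.connected (triangle a b d \<inter> triangle a c d)"
      using connected_path_image[OF arc_imp_path[OF curve(1)[OF e'(3)]]] by simp
  qed (use abd acd in \<open>auto intro: compact_imp_closed\<close>)
  then have "connected_component (- (triangle a b d \<union> triangle a c d \<union> triangle b c d)) p q"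
  proof (rule Janiszewski[rotated 3])
    have "(triangle a b d \<union> triangle a c d) \<inter> triangle b c d = curve b d \<union> curve c d"
    proof
      show "(triangle a b d \<union> triangle a c d) \<inter> triangle b c d \<subseteq> curve b d \<union> curve c d"
      proof
        fix s assume s: "s \<in> (triangle a b d \<union> triangle a c d) \<inter> triangle b c d"
        show "s \<in> curve b d \<union> curve c d"
        proof (rule ccontr)
          assume no: "s \<notin> curve b d \<union> curve c d"
          then have "s \<in> curve b c" "s \<in> curve a b \<union> curve a c \<union> curve d a"
            using s curve_commute[OF e(5)] by (auto simp: triangle_def)
          then obtain x y where *: "(x, y) \<in> {(a, b), (a, c), (d, a)}" "s \<in> curve x y" by auto
          then have "(x, y) \<in> E" "{x, y} \<noteq> {b, c}"
            using e e' neq by (auto simp: doubleton_eq_iff)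
          then obtain v where "v \<in> {x, y} \<inter> {b, c}" "s = pos v"
            using curves_meet[OF _ e(4) _ *(2) \<open>s \<in> curve b c\<close>] by metis
          then have "s \<in> {pos b, pos c}" by auto
          with no ends_in_curve[OF e(5)] ends_in_curve[OF e(6)] show False by auto
        qed
      qed
      show "curve b d \<union> curve c d \<subseteq> (triangle a b d \<union> triangle a c d) \<inter> triangle b c d"
        using curve_commute[OF e(5)] by (auto simp: triangle_def)
    qed
    moreover have "pos d \<in> curve b d \<inter> curve c d"
      using ends_in_curve[OF e(5)] ends_in_curve[OF e(6)] by blast
    ultimately show "topological_space_class.connected
        ((triangle a b d \<union> triangle a c d) \<inter> triangle b c d)"
      using connected_path_image[OF arc_imp_path[OF curve(1)[OF e(5)]]]
        connected_path_image[OF arc_imp_path[OF curve(1)[OF e(6)]]]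
      by (metis connected_Un empty_iff)
  qed (use abd acd bcd in \<open>auto intro: compact_imp_closed\<close>)
  then have "connected_component (- triangle a b c) p q"
    by (rule connected_component_of_subset)
      (use curve_commute[OF e(2)] in \<open>auto simp: triangle_def\<close>)
  moreover have "q \<in> outside (triangle a b c)"
    using q outside_mono[OF TD[OF e(1,4) e'(2)]] by blast
  ultimately have "p \<in> outside (triangle a b c)"
    using outside_same_component connected_component_sym by blast
  with p J show False by blast
qed

lemma connected_remove_vertex:
  assumes "k_connected 2 G" "x \<in> V"
  shows "connected_on E (V - {x})"
proof -
  have "Digraph_Component.connected (with_proj G \<restriction> (V - {x}))"
    using assms by (auto simp: k_connected_def)
  then have r: "(u, w) \<in> rtrancl_on (V - {x}) (parcs (mk_symmetric (with_proj G \<restriction> (V - {x}))))"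
    if "u \<in> V - {x}" "w \<in> V - {x}" for u w
    using that
    by (auto simp: Digraph_Component.connected_def strongly_connected_def reachable_def
        mk_symmetric_def)
  have "parcs (mk_symmetric (with_proj G \<restriction> (V - {x}))) \<subseteq> E"
    using sym_E by (auto simp: mk_symmetric_def induce_subgraph_def)
  with r show ?thesis
    unfolding connected_on_def by (meson rtrancl_on_mono order_refl)
qed

theorem two_tree_vertices:
  assumes "k_connected 2 G"
  shows "two_tree E V"
  using assms finite_V chordal K4_free connected_remove_vertex
  by (intro chordal_two_tree) (auto simp: k_connected_def)

end

section \<open>The monomials of the graph polynomial\<close>

lemma graph_poly_eq_orientation_poly:
  assumes "\<And>u w. (u, w) \<in> parcs G \<Longrightarrow> u \<in> pverts G \<and> w \<in> pverts G"
  shows "graph_poly prec G = orientation_poly (parcs G) prec (pverts G)"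
  unfolding graph_poly_def orientation_poly_def
  by (intro prod.cong) (use assms in auto)

lemma deficit_one:
  "deficit V (\<lambda>_. 1) m = 2 * int (card V) - int (\<Sum>v\<in>V. Poly_Mapping.lookup m v)"
  by (simp add: deficit_def sum_subtractf)

locale named_vertices =
  fixes x y :: 'a and v :: "nat \<Rightarrow> 'a" and n :: nat
  assumes distinct: "x \<noteq> y" "x \<notin> v ` {1..n}" "y \<notin> v ` {1..n}" "inj_on v {1..n}"
begin

abbreviation "monomial \<equiv> xyv_monomial x y v n"
definition "vertices = {x, y} \<union> v ` {1..n}"

lemma lookup_monomial:
  "Poly_Mapping.lookup (monomial \<beta> \<gamma> \<alpha>) x = \<beta>"
  "Poly_Mapping.lookup (monomial \<beta> \<gamma> \<alpha>) y = \<gamma>"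
  "i \<in> {1..n} \<Longrightarrow> Poly_Mapping.lookup (monomial \<beta> \<gamma> \<alpha>) (v i) = \<alpha> i"
  "w \<notin> vertices \<Longrightarrow> Poly_Mapping.lookup (monomial \<beta> \<gamma> \<alpha>) w = 0"
proof -
  let ?S = "\<Sum>i = 1..n. Poly_Mapping.single (v i) (\<alpha> i)"
  have S: "Poly_Mapping.lookup ?S w = (\<Sum>i = 1..n. if v i = w then \<alpha> i else 0)" for w
    by (simp add: lookup_sum lookup_single when_def)
  have S0: "Poly_Mapping.lookup ?S w = 0" if "w \<notin> v ` {1..n}" for w
    unfolding S using that by (intro sum.neutral) auto
  have Sv: "Poly_Mapping.lookup ?S (v i) = \<alpha> i" if i: "i \<in> {1..n}" for i
  proof -
    have "(\<Sum>j = 1..n. if v j = v i then \<alpha> j else 0) = (\<Sum>j = 1..n. if j = i then \<alpha> j else 0)"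
    proof (rule sum.cong)
      fix j assume "j \<in> {1..n}"
      then have "v j = v i \<longleftrightarrow> j = i" using inj_on_eq_iff[OF distinct(4)] i by blast
      then show "(if v j = v i then \<alpha> j else 0) = (if j = i then \<alpha> j else 0)" by simp
    qed simp
    then show ?thesis unfolding S using i by simp
  qed
  show "Poly_Mapping.lookup (monomial \<beta> \<gamma> \<alpha>) x = \<beta>"
    using distinct(1) S0[OF distinct(2)]
    by (simp add: xyv_monomial_def lookup_add lookup_single when_def)
  show "Poly_Mapping.lookup (monomial \<beta> \<gamma> \<alpha>) y = \<gamma>"
    using distinct(1) S0[OF distinct(3)]
    by (simp add: xyv_monomial_def lookup_add lookup_single when_def)
  show "Poly_Mapping.lookup (monomial \<beta> \<gamma> \<alpha>) (v i) = \<alpha> i" if i: "i \<in> {1..n}" for i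
  proof -
    have "x \<noteq> v i" "y \<noteq> v i" using distinct(2,3) i by blast+
    then show ?thesis
      using Sv[OF i] by (simp add: xyv_monomial_def lookup_add lookup_single when_def)
  qed
  show "Poly_Mapping.lookup (monomial \<beta> \<gamma> \<alpha>) w = 0" if w: "w \<notin> vertices" for w
  proof -
    have "w \<noteq> x" "w \<noteq> y" "w \<notin> v ` {1..n}" using w unfolding vertices_def by blast+
    then show ?thesis
      using S0[of w] by (simp add: xyv_monomial_def lookup_add lookup_single when_def)
  qed
qed

lemma sum_vertices: "(\<Sum>w\<in>vertices. f w) = f x + f y + (\<Sum>i = 1..n. f (v i))"
  for f :: "'a \<Rightarrow> 'b :: comm_monoid_add"
proof -
  have "(\<Sum>w\<in>v ` {1..n}. f w) = (\<Sum>i = 1..n. f (v i))"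
    using sum.reindex[OF distinct(4), of f] by (simp add: o_def)
  then show ?thesis using distinct(1-3) by (simp add: vertices_def add.assoc)
qed

lemma card_vertices: "card vertices = n + 2"
  using sum_vertices[of "\<lambda>_. 1 :: nat"] by simp

lemma deficit_monomial:
  "deficit vertices f (monomial \<beta> \<gamma> \<alpha>) =
     (2 - int \<beta>) * f x + (2 - int \<gamma>) * f y + (\<Sum>i = 1..n. (2 - int (\<alpha> i)) * f (v i))"
  unfolding deficit_def sum_vertices by (simp add: lookup_monomial)

lemma keys_monomial: "Poly_Mapping.keys (monomial \<beta> \<gamma> \<alpha>) \<subseteq> vertices"
proof
  fix w assume "w \<in> Poly_Mapping.keys (monomial \<beta> \<gamma> \<alpha>)"
  then have "Poly_Mapping.lookup (monomial \<beta> \<gamma> \<alpha>) w \<noteq> 0" by (simp add: in_keys_iff)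
  then show "w \<in> vertices" using lookup_monomial(4) by metis
qed

lemma monomial_le:
  assumes "\<beta> \<le> 2" "\<gamma> \<le> 2" "\<forall>i\<in>{1..n}. \<alpha> i \<le> 2" "w \<in> vertices"
  shows "Poly_Mapping.lookup (monomial \<beta> \<gamma> \<alpha>) w \<le> 2"
proof -
  consider "w = x" | "w = y" | i where "i \<in> {1..n}" "w = v i"
    using assms(4) unfolding vertices_def by blast
  then show ?thesis
    by cases (use assms(1-3) in \<open>simp_all add: lookup_monomial\<close>)
qed

end

theorem corollary2p2:
  fixes G :: "'a pair_pre_digraph"
    and pos :: "'a \<Rightarrow> complex"
    and crv :: "'a \<times> 'a \<Rightarrow> real \<Rightarrow> complex"
    and prec :: "'a \<Rightarrow> 'a \<Rightarrow> bool"
    and x y :: 'a and v :: "nat \<Rightarrow> 'a" and n :: nat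
    and C :: "'a \<Rightarrow> nat"
  assumes "outerplane_graph G pos crv"
    and "near_triangulation G pos crv"
    and "k_connected 2 G"
    and "pverts G = {x, y} \<union> v ` {1..n}"
    and "x \<noteq> y" and "x \<notin> v ` {1..n}" and "y \<notin> v ` {1..n}" and "inj_on v {1..n}"
    and "proper_colouring G {1, 2, 3} C"
    and "orients prec G"
  shows
    "(\<not> (\<exists>\<alpha>. (\<forall>i\<in>{1..n}. \<alpha> i \<le> 2) \<and>
        nonvanishing (graph_poly prec G) (xyv_monomial x y v n 0 0 \<alpha>))) \<and>
     ((\<exists>\<alpha>. (\<forall>i\<in>{1..n}. \<alpha> i \<le> 2) \<and>
        nonvanishing (graph_poly prec G) (xyv_monomial x y v n 1 0 \<alpha>)) \<longleftrightarrow> C x \<noteq> C y) \<and>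
     (\<exists>\<beta> \<gamma> \<alpha>. \<beta> \<le> 1 \<and> \<gamma> \<le> 1 \<and> (\<forall>i\<in>{1..n}. \<alpha> i \<le> 2) \<and>
        nonvanishing (graph_poly prec G) (xyv_monomial x y v n \<beta> \<gamma> \<alpha>))"
proof -
  interpret outerplane_near_triangulation G pos crv
    using assms(1,2) by unfold_locales (auto simp: outerplane_graph_def)
  interpret oriented_graph "parcs G" prec
    using assms(10) by unfold_locales (auto simp: orients_def)
  interpret named_vertices x y v n
    using assms(5-8) by unfold_locales
  define c where "c w = int (C w)" for w
  have V: "pverts G = vertices" using assms(4) by (simp add: vertices_def)
  have tree: "two_tree (parcs G) vertices"
    using two_tree_vertices[OF assms(3)] V by simp
  have col: "C w \<in> {1, 2, 3}" if "w \<in> vertices" for w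
    using assms(9) that V unfolding proper_colouring_def by blast
  have proper: "C u \<noteq> C w" if "(u, w) \<in> parcs G" for u w
    using assms(9) that unfolding proper_colouring_def by blast
  have poly: "graph_poly prec G = orientation_poly (parcs G) prec vertices"
    using graph_poly_eq_orientation_poly[OF edge_in_V] V by simp
  have c3: "c w \<in> {1, 2, 3}" if "w \<in> vertices" for w
    using col[OF that] by (auto simp: c_def)
  have c_neq: "c u \<noteq> c w" if "(u, w) \<in> parcs G" for u w
    using proper[OF that] by (simp add: c_def)
  obtain s where s: "s \<noteq> 0" and law: "chi_law vertices c s (graph_poly prec G)"
    using coefficient_two_tree[OF tree, of c] c3 c_neq unfolding poly by metis
  have xy: "c x \<in> {1, 2, 3}" "c y \<in> {1, 2, 3}" using c3 by (simp_all add: vertices_def)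
  have nonvanishing_iff: "nonvanishing (graph_poly prec G) (monomial \<beta> \<gamma> \<alpha>) \<longleftrightarrow>
      deficit vertices (\<lambda>_. 1) (monomial \<beta> \<gamma> \<alpha>) = 3 \<and>
      \<not> 3 dvd deficit vertices c (monomial \<beta> \<gamma> \<alpha>)"
    if "\<beta> \<le> 2" "\<gamma> \<le> 2" "\<forall>i\<in>{1..n}. \<alpha> i \<le> 2" for \<beta> \<gamma> \<alpha>
  proof (cases "deficit vertices (\<lambda>_. 1) (monomial \<beta> \<gamma> \<alpha>) = 3")
    case True
    then have "Poly_Mapping.lookup (graph_poly prec G) (monomial \<beta> \<gamma> \<alpha>) =
        s * chi (deficit vertices c (monomial \<beta> \<gamma> \<alpha>))"
      using law keys_monomial monomial_le[OF that] unfolding chi_law_def by blast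
    with True s show ?thesis by (simp add: nonvanishing_def chi_eq_0_iff)
  next
    case False
    have "homogeneous_on vertices (2 * card vertices - 3) (graph_poly prec G)"
      unfolding poly using orientation_poly_homogeneous[OF tree] by blast
    moreover have "(\<Sum>w\<in>vertices. Poly_Mapping.lookup (monomial \<beta> \<gamma> \<alpha>) w) \<noteq> 2 * card vertices - 3"
      using False by (auto simp: deficit_one card_vertices simp del: of_nat_sum)
    ultimately have "Poly_Mapping.lookup (graph_poly prec G) (monomial \<beta> \<gamma> \<alpha>) = 0"
      unfolding homogeneous_on_def by blast
    with False show ?thesis by (simp add: nonvanishing_def)
  qed
  have part1: "\<not> nonvanishing (graph_poly prec G) (monomial 0 0 \<alpha>)"
    if "\<forall>i\<in>{1..n}. \<alpha> i \<le> 2" for \<alpha>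
  proof -
    have "0 \<le> (\<Sum>i = 1..n. 2 - int (\<alpha> i))" using that by (intro sum_nonneg) force
    then have "deficit vertices (\<lambda>_. 1) (monomial 0 0 \<alpha>) \<noteq> 3"
      by (simp add: deficit_monomial)
    then show ?thesis using that by (simp add: nonvanishing_iff)
  qed
  \<comment> \<open>Total deficit 3 with exponents 1 at \<open>x\<close> and 0 at \<open>y\<close> leaves no deficit for the other vertices,
    and \<open>c x + 2 * c y\<close> is \<open>c x - c y\<close> modulo 3.\<close>
  have all_two: "nonvanishing (graph_poly prec G) (monomial 1 0 (\<lambda>_. 2)) \<longleftrightarrow> \<not> 3 dvd c x + 2 * c y"
    by (simp add: nonvanishing_iff deficit_monomial)
  have dvd_iff: "3 dvd c x + 2 * c y \<longleftrightarrow> C x = C y"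
  proof -
    have "3 dvd c x + 2 * c y \<longleftrightarrow> c x = c y" using xy by auto
    then show ?thesis by (simp add: c_def)
  qed
  have part2: "C x \<noteq> C y"
    if "\<forall>i\<in>{1..n}. \<alpha> i \<le> 2" "nonvanishing (graph_poly prec G) (monomial 1 0 \<alpha>)" for \<alpha>
  proof -
    have d: "deficit vertices (\<lambda>_. 1) (monomial 1 0 \<alpha>) = 3"
      and nd: "\<not> 3 dvd deficit vertices c (monomial 1 0 \<alpha>)"
      using that by (simp_all add: nonvanishing_iff)
    have "(\<Sum>i = 1..n. 2 - int (\<alpha> i)) = 0" using d by (simp add: deficit_monomial)
    then have "\<forall>i\<in>{1..n}. 2 - int (\<alpha> i) = 0"
      using that(1) by (subst (asm) sum_nonneg_eq_0_iff) force+
    then have "deficit vertices c (monomial 1 0 \<alpha>) = c x + 2 * c y"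
      by (simp add: deficit_monomial)
    with nd dvd_iff show ?thesis by simp
  qed
  have part3: "\<exists>\<beta> \<gamma> \<alpha>. \<beta> \<le> 1 \<and> \<gamma> \<le> 1 \<and> (\<forall>i\<in>{1..n}. \<alpha> i \<le> 2) \<and>
        nonvanishing (graph_poly prec G) (monomial \<beta> \<gamma> \<alpha>)"
  proof (cases "C x = C y")
    case False
    with all_two dvd_iff have "nonvanishing (graph_poly prec G) (monomial 1 0 (\<lambda>_. 2))" by blast
    then show ?thesis
      by (intro exI[of _ "1 :: nat"] exI[of _ "0 :: nat"] exI[of _ "\<lambda>_. 2 :: nat"] conjI) simp_all
  next
    case True
    \<comment> \<open>Spread the deficit 3 over \<open>x\<close>, \<open>y\<close> and a vertex of another colour: no three colours, two
      of them equal and the third different, add up to a multiple of 3.\<close>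
    obtain p q where pq: "p \<in> vertices" "q \<in> vertices" "(p, q) \<in> parcs G"
      using two_tree_contains_edge[OF tree] by blast
    then obtain w where w: "w \<in> vertices" "C w \<noteq> C x" using proper[OF pq(3)] by metis
    then obtain j where j: "j \<in> {1..n}" "w = v j" using True unfolding vertices_def by auto
    define \<alpha> where "\<alpha> i = (if i = j then 1 else 2 :: nat)" for i
    have sum: "(\<Sum>i = 1..n. (2 - int (\<alpha> i)) * f (v i)) = f w" for f :: "'a \<Rightarrow> int"
    proof -
      have "(\<Sum>i = 1..n. (2 - int (\<alpha> i)) * f (v i)) = (\<Sum>i = 1..n. if i = j then f (v i) else 0)"
        by (intro sum.cong) (auto simp: \<alpha>_def)
      then show ?thesis using j by simp
    qed
    have "deficit vertices (\<lambda>_. 1) (monomial 1 1 \<alpha>) = 3"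
      using sum[of "\<lambda>_. 1"] by (simp add: deficit_monomial)
    moreover have "deficit vertices c (monomial 1 1 \<alpha>) = c x + c y + c w"
      using sum[of c] by (simp add: deficit_monomial)
    moreover have "\<not> 3 dvd c x + c y + c w"
    proof -
      have "c x = c y" "c w \<noteq> c x" using True w(2) by (simp_all add: c_def)
      then show ?thesis using xy c3[OF w(1)] by auto
    qed
    moreover have "\<forall>i\<in>{1..n}. \<alpha> i \<le> 2" by (simp add: \<alpha>_def)
    ultimately have "nonvanishing (graph_poly prec G) (monomial 1 1 \<alpha>)" "\<forall>i\<in>{1..n}. \<alpha> i \<le> 2"
      by (simp_all add: nonvanishing_iff)
    then show ?thesis by (meson order_refl)
  qed
  show ?thesis
  proof (intro conjI)
    show "\<not> (\<exists>\<alpha>. (\<forall>i\<in>{1..n}. \<alpha> i \<le> 2) \<and>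
        nonvanishing (graph_poly prec G) (monomial 0 0 \<alpha>))"
      using part1 by blast
    show "(\<exists>\<alpha>. (\<forall>i\<in>{1..n}. \<alpha> i \<le> 2) \<and>
        nonvanishing (graph_poly prec G) (monomial 1 0 \<alpha>)) \<longleftrightarrow> C x \<noteq> C y"
    proof
      assume "C x \<noteq> C y"
      with all_two dvd_iff have "nonvanishing (graph_poly prec G) (monomial 1 0 (\<lambda>_. 2))" by blast
      then show "\<exists>\<alpha>. (\<forall>i\<in>{1..n}. \<alpha> i \<le> 2) \<and>
          nonvanishing (graph_poly prec G) (monomial 1 0 \<alpha>)"
        by (intro exI[of _ "\<lambda>_. 2"]) simp
    qed (use part2 in blast)
  qed (rule part3)
qed

end
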